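(* Let $n\ge 2$ and $r\ge 1$, and let $i$ be a non-negative integer. If $\mathrm{Z}:\mathcal{P}(\mathbb{Z}^n)\to\mathbb{T}^r$ is an $i$-homogeneous and translation covariant valuation, then $$\mathrm{Z}^\circ(P)=(-1)^i\,\mathrm{Z}(-P)$$ for $P\in\mathcal{P}(\mathbb{Z}^n)$.
   Context: $\mathbb{N}$ is the set of non-negative integers. $\mathcal{P}(\mathbb{Z}^n)$ is the set of lattice polytopes in $\mathbb{R}^n$, i.e. convex polytopes with vertices in $\mathbb{Z}^n$ (the empty set is included). $\mathbb{T}^r$ is the vector space of symmetric tensors of rank $r$ on $\mathbb{R}^n$, identified via the scalar product with symmetric $r$-linear functionals on $(\mathbb{R}^n)^r$; $\mathbb{T}^0=\mathbb{R}$. For $x\in\mathbb{R}^n$, $x^r\in\mathbb{T}^r$ is the $r$-fold symmetric tensor product, $x^r(v_1,\dots,v_r)=(x\cdot v_1)\cdots(x\cdot v_r)$, and $x^0=1$. Products of symmetric tensors are symmetric tensor products: for $A\in\mathbb{T}^{p}$, $B\in\mathbb{T}^{q}$, $(AB)(v_1,\dots,v_{p+q})=\frac{1}{(p+q)!}\sum_\sigma A(v_{\sigma(1)},\dots,v_{\sigma(p)})B(v_{\sigma(p+1)},\dots,v_{\sigma(p+q)})$, summing over all permutations $\sigma$ of $1,\dots,p+q$. A function $\mathrm{Z}:\mathcal{P}(\mathbb{Z}^n)\to\mathbb{T}^r$ is: a valuation if $\mathrm{Z}(\emptyset)=0$ and $\mathrm{Z}(P)+\mathrm{Z}(Q)=\mathrm{Z}(P\cup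 Q)+\mathrm{Z}(P\cap Q)$ whenever $P,Q,P\cup Q,P\cap Q\in\mathcal{P}(\mathbb{Z}^n)$; $i$-homogeneous if $\mathrm{Z}(kP)=k^i\mathrm{Z}(P)$ for all $k\in\mathbb{N}$ and $P\in\mathcal{P}(\mathbb{Z}^n)$ (with $0^0=1$). A valuation $\mathrm{Z}$ is translation covariant if there are functions $\mathrm{Z}^j:\mathcal{P}(\mathbb{Z}^n)\to\mathbb{T}^j$, $j=0,\dots,r$, such that $\mathrm{Z}(P+y)=\sum_{j=0}^r\mathrm{Z}^{r-j}(P)\frac{y^j}{j!}$ for all $y\in\mathbb{Z}^n$ and $P\in\mathcal{P}(\mathbb{Z}^n)$. For $\mathrm{Z}:\mathcal{P}(\mathbb{Z}^n)\to\mathbb{T}^r$, the function $\mathrm{Z}^\circ:\mathcal{P}(\mathbb{Z}^n)\to\mathbb{T}^r$ is defined by $\mathrm{Z}^\circ(P)=\sum_F(-1)^{\dim(F)}\mathrm{Z}(F)$, where the sum extends over all non-empty faces $F$ of $P$ (including $P$ itself). $-P=\{-x:x\in P\}$. *)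

theory Defs
  imports "HOL-Analysis.Analysis"
begin

definition int_lattice :: "(real ^ 'n) set"
  where "int_lattice = {x. \<forall>k. x $ k \<in> \<int>}"

definition lattice_polytopes :: "(real ^ 'n) set set"
  where "lattice_polytopes = {P. polytope P \<and> {x. x extreme_point_of P} \<subseteq> int_lattice}"

text \<open>
  A tensor of rank \<open>r\<close> is a functional of the arguments \<open>v 0, \<dots>, v (r - 1)\<close>. All ranks share
  one type because the argument is an infinite sequence; the first clause of \<open>sym_tensors\<close> makes
  the entries from index \<open>r\<close> on irrelevant, so that equality of tensors of rank \<open>r\<close> is equality
  of functions, and rank \<open>0\<close> consists of the constant functions, i.e. the real numbers.
\<close>

type_synonym 'n tensor = "(nat \<Rightarrow> real ^ 'n) \<Rightarrow> real"

definition sym_tensors :: "nat \<Rightarrow> ('n::finite) tensor set"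
  where "sym_tensors r = {A.
    (\<forall>v w. (\<forall>k<r. v k = w k) \<longrightarrow> A v = A w) \<and>
    (\<forall>v. \<forall>k<r. linear (\<lambda>x. A (v(k := x)))) \<and>
    (\<forall>v \<sigma>. \<sigma> permutes {..<r} \<longrightarrow> A (\<lambda>k. v (\<sigma> k)) = A v)}"

definition tensor_power :: "real ^ 'n \<Rightarrow> nat \<Rightarrow> ('n::finite) tensor"
  where "tensor_power x r = (\<lambda>v. \<Prod>k<r. x \<bullet> v k)"

text \<open>The ranks \<open>p\<close> of \<open>A\<close> and \<open>q\<close> of \<open>B\<close> cannot be read off the type, so they are arguments.\<close>

definition sym_prod :: "nat \<Rightarrow> nat \<Rightarrow> 'n tensor \<Rightarrow> 'n tensor \<Rightarrow> ('n::finite) tensor"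
  where "sym_prod p q A B = (\<lambda>v.
    (\<Sum>\<sigma> | \<sigma> permutes {..<p + q}. A (\<lambda>k. v (\<sigma> k)) * B (\<lambda>k. v (\<sigma> (p + k)))) / fact (p + q))"

definition tensor_valuation :: "nat \<Rightarrow> ((real ^ 'n) set \<Rightarrow> ('n::finite) tensor) \<Rightarrow> bool"
  where "tensor_valuation r Z \<longleftrightarrow>
    Z \<in> lattice_polytopes \<rightarrow> sym_tensors r \<and>
    (\<forall>v. Z {} v = 0) \<and>
    (\<forall>P Q. P \<in> lattice_polytopes \<and> Q \<in> lattice_polytopes \<and>
       P \<union> Q \<in> lattice_polytopes \<and> P \<inter> Q \<in> lattice_polytopes \<longrightarrow>
       (\<forall>v. Z P v + Z Q v = Z (P \<union> Q) v + Z (P \<inter> Q) v))"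

definition homogeneous :: "nat \<Rightarrow> ((real ^ 'n) set \<Rightarrow> ('n::finite) tensor) \<Rightarrow> bool"
  where "homogeneous i Z \<longleftrightarrow>
    (\<forall>k::nat. \<forall>P \<in> lattice_polytopes. \<forall>v. Z ((\<lambda>x. real k *\<^sub>R x) ` P) v = real k ^ i * Z P v)"

definition translation_covariant :: "nat \<Rightarrow> ((real ^ 'n) set \<Rightarrow> ('n::finite) tensor) \<Rightarrow> bool"
  where "translation_covariant r Z \<longleftrightarrow>
    (\<exists>Zs :: nat \<Rightarrow> (real ^ 'n) set \<Rightarrow> 'n tensor.
       (\<forall>j\<le>r. Zs j \<in> lattice_polytopes \<rightarrow> sym_tensors j) \<and>
       (\<forall>y \<in> int_lattice. \<forall>P \<in> lattice_polytopes. \<forall>v.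
          Z ((\<lambda>x. x + y) ` P) v =
            (\<Sum>j\<le>r. sym_prod (r - j) j (Zs (r - j) P) (tensor_power y j) v / fact j)))"

definition face_alternating_sum ::
    "((real ^ 'n) set \<Rightarrow> ('n::finite) tensor) \<Rightarrow> (real ^ 'n) set \<Rightarrow> 'n tensor"
  where "face_alternating_sum Z P =
    (\<lambda>v. \<Sum>F | F face_of P \<and> F \<noteq> {}. (- 1) ^ nat (aff_dim F) * Z F v)"

end

theory Submission
  imports Defs
begin

text \<open>
  Fixing the arguments of the tensors turns \<open>Z\<close> into a real-valued valuation \<open>\<phi>\<close> on lattice polytopes
  such that \<open>\<phi> (k P) = k ^ i * \<phi> P\<close> and \<open>y \<mapsto> \<phi> (P + y)\<close> is a polynomial on the lattice. The claim is
  that the signed sum of \<open>\<phi>\<close> over the faces of \<open>P\<close> is \<open>\<psi> P\<close>, where \<open>\<psi> P = (-1) ^ i * \<phi> (- P)\<close>.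
  The argument has three ideas.

  \<^emph>\<open>Reflection.\<close> Let \<open>P\<close> be the convex hull of lattice points \<open>v l\<close> with \<open>l \<in> I\<close>. The polytope
  \<open>(k + |J|) P - (\<Sum>l\<in>J. v l)\<close> is the image of the shifted simplex
  \<open>{t. \<Sum>t = k, t l \<ge> -1 on J, t l \<ge> 0 off J}\<close> under the linear map \<open>t \<mapsto> (\<Sum>l\<in>I. t l v l)\<close>. Cutting with
  the coordinate hyperplanes shows that the alternating sum over \<open>J\<close> of the values of \<open>\<phi>\<close> at these images
  equals the one for the sets \<open>{t. \<Sum>t = k, -1 \<le> t l \<le> 0 on J, t l = 0 off J}\<close>
  (\<open>slice_exchange\<close>). The latter are all empty for \<open>k \<ge> 1\<close>, all equal to \<open>{0}\<close> for \<open>k = 0\<close>, and they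
  project to \<open>- conv (v ` J)\<close> for \<open>k = -1\<close>. The cases \<open>k \<ge> 0\<close> say that iterated differences of the
  function \<open>(k, y) \<mapsto> \<phi> (k P + y)\<close> vanish, which forces it to be a homogeneous polynomial of degree \<open>i\<close>,
  even at \<open>k = 0\<close>. If \<open>I\<close> has more than \<open>i\<close> elements, then the differences of that polynomial also
  vanish at \<open>k = -1\<close>, where its value is \<open>(-1) ^ i * \<phi> P\<close>; this gives \<open>reflection\<close>, that is
  \<open>(-1) ^ i * \<phi> P = (\<Sum>U. (-1) ^ (|U| - 1) * \<phi> (- conv U))\<close>, where \<open>U\<close> runs over the nonempty subsets of
  any finite set of lattice points with convex hull \<open>P\<close>. Hence \<open>\<phi>\<close> and \<open>\<psi>\<close> are obtained from each other
  by the same alternating sum over a generating set.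

  \<^emph>\<open>Induction on the number of generators.\<close> For affinely independent points every subset generates a
  face, so the formula for \<open>\<psi>\<close> is already the claim. Otherwise, after a dilation of \<open>P\<close>, its generating set
  \<open>V\<close> has a lattice point \<open>q\<close> such that \<open>q \<in> conv (V - {u})\<close> for each \<open>u \<in> V\<close>
  (\<open>integral_Radon_point\<close>). Every nonempty subset of \<open>insert q V\<close> other than \<open>V\<close> and \<open>insert q V\<close> has a
  hull that is generated by fewer than \<open>|V|\<close> points, while these two have the same hull and opposite
  signs. By induction the alternating sums over all hulls of the face sums of \<open>\<phi>\<close> and of the values of \<open>\<psi>\<close>
  therefore agree, and the latter sum is \<open>\<phi> P\<close> up to sign.

  \<^emph>\<open>Counting faces of hulls.\<close> In the alternating sum of face sums over all hulls \<open>conv U\<close>, the value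
  \<open>\<phi> (conv W)\<close> occurs once for each \<open>B\<close> such that \<open>conv W\<close> is a face of \<open>conv (W \<union> B)\<close> without points
  of \<open>B\<close>, which means that the directions from \<open>W\<close> to \<open>B\<close> lie in an open half-space whose boundary contains the directions of
  \<open>W\<close>. The signed number of these \<open>B\<close> is \<open>0\<close> if \<open>W\<close> lies in a proper face of \<open>P\<close>, and \<open>1\<close> or \<open>-1\<close>
  according to the parity of \<open>dim P - dim W\<close> if not (\<open>alternating_sum_separable\<close>). So \<open>\<phi> P\<close> is, up to
  sign, an alternating sum of \<open>\<phi> (conv W)\<close> over those \<open>W\<close> that lie in no proper face of \<open>P\<close>. The same holds for
  each face of \<open>P\<close>, and since each \<open>W\<close> determines the smallest face that contains it, adding up over
  the faces yields the alternating sum over all \<open>W\<close>, which is \<open>\<psi> P\<close>.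
\<close>

section \<open>Alternating sums over subsets\<close>

definition alternating_sum :: "'b set \<Rightarrow> ('b set \<Rightarrow> real) \<Rightarrow> real"
  where "alternating_sum I f = (\<Sum>B\<in>Pow I. (- 1) ^ card B * f B)"

lemma alternating_sum_cong:
  assumes "\<And>B. B \<subseteq> I \<Longrightarrow> f B = g B"
  shows "alternating_sum I f = alternating_sum I g"
  unfolding alternating_sum_def by (rule sum.cong) (auto simp: assms)

lemma alternating_sum_diff:
  "alternating_sum I (\<lambda>B. f B - g B) = alternating_sum I f - alternating_sum I g"
  by (simp add: alternating_sum_def right_diff_distrib sum_subtractf)

lemma alternating_sum_add:
  "alternating_sum I (\<lambda>B. f B + g B) = alternating_sum I f + alternating_sum I g"
  by (simp add: alternating_sum_def distrib_left sum.distrib)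

lemma alternating_sum_cmult:
  "alternating_sum I (\<lambda>B. c * f B) = c * alternating_sum I f"
  by (simp add: alternating_sum_def sum_distrib_left mult_ac)

lemma alternating_sum_sum:
  "alternating_sum I (\<lambda>B. \<Sum>j\<in>S. f j B) = (\<Sum>j\<in>S. alternating_sum I (f j))"
  unfolding alternating_sum_def sum_distrib_left by (rule sum.swap)

lemma alternating_sum_zero [simp]: "alternating_sum I (\<lambda>B. 0) = 0"
  by (simp add: alternating_sum_def)

lemma alternating_sum_empty [simp]: "alternating_sum {} f = f {}"
  by (simp add: alternating_sum_def)

lemma alternating_sum_insert:
  assumes "finite I" "x \<notin> I"
  shows "alternating_sum (insert x I) f
    = alternating_sum I f - alternating_sum I (\<lambda>B. f (insert x B))"
proof -
  have inj: "inj_on (insert x) (Pow I)"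
    using assms(2) by (intro inj_onI) (metis Pow_iff insert_ident subset_iff)
  have "Pow I \<inter> insert x ` Pow I = {}"
    using assms(2) by auto
  then have "alternating_sum (insert x I) f
    = alternating_sum I f + (\<Sum>B\<in>insert x ` Pow I. (- 1) ^ card B * f B)"
    unfolding alternating_sum_def Pow_insert using assms(1) by (subst sum.union_disjoint) auto
  also have "(\<Sum>B\<in>insert x ` Pow I. (- 1) ^ card B * f B)
    = (\<Sum>B\<in>Pow I. (- 1) ^ card (insert x B) * f (insert x B))"
    using sum.reindex[OF inj] by simp
  also have "\<dots> = - alternating_sum I (\<lambda>B. f (insert x B))"
    unfolding alternating_sum_def sum_negf[symmetric]
  proof (rule sum.cong[OF refl])
    fix B assume "B \<in> Pow I"
    then have "finite B" "x \<notin> B"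
      using assms finite_subset by auto
    then show "(- 1) ^ card (insert x B) * f (insert x B) = - ((- 1) ^ card B * f (insert x B))"
      by simp
  qed
  finally show ?thesis
    by simp
qed

lemma alternating_sum_cancel:
  assumes "finite I" "x \<in> I" and "\<And>B. B \<subseteq> I - {x} \<Longrightarrow> f (insert x B) = f B"
  shows "alternating_sum I f = 0"
proof -
  have "alternating_sum (insert x (I - {x})) f
    = alternating_sum (I - {x}) f - alternating_sum (I - {x}) (\<lambda>B. f (insert x B))"
    using assms(1) by (intro alternating_sum_insert) auto
  also have "\<dots> = 0"
    using alternating_sum_cong[of "I - {x}" "\<lambda>B. f (insert x B)" f] assms(3) by simp
  finally show ?thesis
    using assms(2) by (simp add: insert_absorb)
qed

text \<open>
  A function \<open>F\<close> of families of states that changes in the same way when \<open>p\<close> is replaced by \<open>q\<close> as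
  when \<open>p'\<close> is replaced by \<open>q'\<close> has the same mixed difference over \<open>I\<close> for both pairs of
  states: exchange the coordinates one after the other. In the applications a state is the interval in
  which a coordinate is confined, \<open>F\<close> evaluates a valuation at the resulting polyhedron, and the
  hypothesis is the valuation property for a cut by one hyperplane: either \<open>q = p \<union> q'\<close> and
  \<open>p' = p \<inter> q'\<close>, or \<open>p = q \<union> p'\<close> and \<open>q' = q \<inter> p'\<close>. The set \<open>S\<close>
  restricts the families for which the hypothesis has to be checked.
\<close>

lemma alternating_sum_exchange:
  fixes F :: "('b \<Rightarrow> 'c) \<Rightarrow> real"
  assumes "finite I"
    and "\<And>s l. range s \<subseteq> S \<Longrightarrow> l \<in> I \<Longrightarrow>
      F (s(l := q)) - F (s(l := p)) = F (s(l := q')) - F (s(l := p'))"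
    and "{p, q, p', q'} \<subseteq> S" and "range s \<subseteq> S"
  shows "alternating_sum I (\<lambda>J. F (\<lambda>l. if l \<in> J then p else if l \<in> I then q else s l))
    = alternating_sum I (\<lambda>J. F (\<lambda>l. if l \<in> J then p' else if l \<in> I then q' else s l))"
  using assms
proof (induction I arbitrary: s rule: finite_induct)
  case empty
  then show ?case by simp
next
  case (insert x K)
  have step: "alternating_sum (insert x K)
      (\<lambda>J. F (\<lambda>l. if l \<in> J then u else if l \<in> insert x K then w else s l))
    = alternating_sum K (\<lambda>J. F (\<lambda>l. if l \<in> J then u else if l \<in> K then w else (s(x := w)) l))
    - alternating_sum K (\<lambda>J. F (\<lambda>l. if l \<in> J then u else if l \<in> K then w else (s(x := u)) l))"
    for u w
  proof -
    have "alternating_sum K (\<lambda>J. F (\<lambda>l. if l \<in> J then u else if l \<in> insert x K then w else s l))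
      = alternating_sum K (\<lambda>J. F (\<lambda>l. if l \<in> J then u else if l \<in> K then w else (s(x := w)) l))"
      using insert.hyps by (intro alternating_sum_cong arg_cong[of _ _ F]) auto
    moreover have "alternating_sum K
        (\<lambda>J. F (\<lambda>l. if l \<in> insert x J then u else if l \<in> insert x K then w else s l))
      = alternating_sum K (\<lambda>J. F (\<lambda>l. if l \<in> J then u else if l \<in> K then w else (s(x := u)) l))"
      using insert.hyps by (intro alternating_sum_cong arg_cong[of _ _ F]) auto
    ultimately show ?thesis
      by (simp only: alternating_sum_insert[OF insert.hyps])
  qed
  let ?G = "\<lambda>v. alternating_sum K (\<lambda>J. F (\<lambda>l. if l \<in> J then p' else if l \<in> K then q' else (s(x := v)) l))"
  have IH: "alternating_sum K (\<lambda>J. F (\<lambda>l. if l \<in> J then p else if l \<in> K then q else (s(x := v)) l)) = ?G v"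
    if "v \<in> S" for v
    by (rule insert.IH) (use insert.prems that in auto)
  have "?G q - ?G p = ?G q' - ?G p'"
    unfolding alternating_sum_diff[symmetric]
  proof (rule alternating_sum_cong)
    fix J assume J: "J \<subseteq> K"
    have eq: "(\<lambda>l. if l \<in> J then p' else if l \<in> K then q' else (s(x := v)) l)
      = (\<lambda>l. if l \<in> J then p' else if l \<in> K then q' else s l)(x := v)" for v
      using insert.hyps J by (intro ext) auto
    show "F (\<lambda>l. if l \<in> J then p' else if l \<in> K then q' else (s(x := q)) l)
      - F (\<lambda>l. if l \<in> J then p' else if l \<in> K then q' else (s(x := p)) l)
      = F (\<lambda>l. if l \<in> J then p' else if l \<in> K then q' else (s(x := q')) l)
      - F (\<lambda>l. if l \<in> J then p' else if l \<in> K then q' else (s(x := p')) l)"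
      unfolding eq by (rule insert.prems) (use insert.prems in auto)
  qed
  then show ?case
    using insert.prems unfolding step by (simp add: IH)
qed

text \<open>
  Repeating a generator does not change the sum: the subsets that contain the new index
  \<open>x\<close> cancel in pairs that differ by an index \<open>y\<close> with the same image.
\<close>

lemma alternating_sum_image_duplicates:
  assumes "finite I" "I' \<subseteq> I" "v ` I = v ` I'"
  shows "alternating_sum I (\<lambda>J. f (v ` J)) = alternating_sum I' (\<lambda>J. f (v ` J))"
proof -
  have fin: "finite (I - I')" using assms(1) by simp
  have "alternating_sum (I' \<union> T) (\<lambda>J. f (v ` J)) = alternating_sum I' (\<lambda>J. f (v ` J))"
    if "finite T" "T \<subseteq> I - I'" for T
    using that
  proof (induction T rule: finite_induct)
    case empty
    then show ?case by simp
  next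
    case (insert x T)
    have fin: "finite (I' \<union> T)" using insert assms finite_subset by blast
    have x: "x \<notin> I' \<union> T" using insert by auto
    obtain y where y: "y \<in> I'" "v y = v x"
      using insert.prems assms(3) by (metis DiffD1 image_iff insert_subset)
    have "alternating_sum (I' \<union> T) (\<lambda>J. f (v ` insert x J)) = 0"
    proof (rule alternating_sum_cancel[OF fin, of y])
      show "f (v ` insert x (insert y B)) = f (v ` insert x B)" for B
        using y by (simp add: insert_absorb)
    qed (use y in auto)
    then show ?case
      using alternating_sum_insert[OF fin x, of "\<lambda>J. f (v ` J)"] insert by simp
  qed
  from this[OF fin] show ?thesis
    using assms(2) by (simp add: Un_absorb1)
qed

lemma alternating_sum_reindex:
  assumes "inj_on h I"
  shows "alternating_sum (h ` I) f = alternating_sum I (\<lambda>B. f (h ` B))"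
proof -
  have inj: "inj_on ((`) h) (Pow I)"
    using assms by (rule inj_on_image_Pow)
  have "alternating_sum (h ` I) f = (\<Sum>B\<in>Pow I. (- 1) ^ card (h ` B) * f (h ` B))"
    unfolding alternating_sum_def image_Pow_surj[OF refl, symmetric]
    using sum.reindex[OF inj] by simp
  also have "\<dots> = alternating_sum I (\<lambda>B. f (h ` B))"
    unfolding alternating_sum_def
    by (rule sum.cong[OF refl]) (metis Pow_iff assms card_image inj_on_subset)
  finally show ?thesis .
qed

section \<open>Subsets contained in an open half-space\<close>

definition separable :: "'a::euclidean_space set \<Rightarrow> 'a set \<Rightarrow> bool"
  where "separable D B \<longleftrightarrow> (\<exists>a. (\<forall>d\<in>D. a \<bullet> d = 0) \<and> (\<forall>b\<in>B. a \<bullet> b > 0))"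

lemma exists_large_multiple:
  fixes u w :: "'b \<Rightarrow> real"
  assumes "finite B" "\<And>b. b \<in> B \<Longrightarrow> w b > 0"
  shows "\<exists>M>0. \<forall>b\<in>B. u b + M * w b > 0"
  using assms
proof (induction B rule: finite_induct)
  case empty
  then show ?case by (auto intro: exI[of _ 1])
next
  case (insert x B)
  then obtain M where M: "M > 0" "\<forall>b\<in>B. u b + M * w b > 0" by auto
  let ?M = "max M (\<bar>u x\<bar> / w x + 1)"
  have wx: "w x > 0" using insert by auto
  have "u x + ?M * w x \<ge> u x + (\<bar>u x\<bar> / w x + 1) * w x"
    using wx by (simp add: mult_right_mono)
  also have "u x + (\<bar>u x\<bar> / w x + 1) * w x = u x + \<bar>u x\<bar> + w x"
    using wx by (simp add: distrib_right)
  finally have "u x + ?M * w x > 0" using wx by linarith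
  moreover have "u b + ?M * w b > 0" if "b \<in> B" for b
  proof -
    have "M * w b \<le> ?M * w b" using insert.prems that by (intro mult_right_mono) (auto intro: less_imp_le)
    then show ?thesis using M that by (smt (verit))
  qed
  ultimately show ?case using M by (intro exI[of _ ?M]) auto
qed

text \<open>
  Adding a large multiple of \<open>h\<close> to a functional makes it positive at \<open>x0\<close> and spoils no
  positive value, so separability of \<open>B\<close> does not depend on whether \<open>x0 \<in> B\<close>.
\<close>

lemma alternating_sum_separable_eq_0:
  assumes "finite X" and D: "\<forall>d\<in>D. h \<bullet> d = 0" and X: "\<forall>x\<in>X. h \<bullet> x \<ge> 0"
    and x0: "x0 \<in> X" "h \<bullet> x0 > 0"
  shows "alternating_sum X (\<lambda>B. of_bool (separable D B)) = 0"
proof (rule alternating_sum_cancel[OF assms(1) x0(1)])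
  fix B assume B: "B \<subseteq> X - {x0}"
  have "separable D (insert x0 B)" if sep: "separable D B"
  proof -
    obtain a where a: "\<forall>d\<in>D. a \<bullet> d = 0" "\<forall>b\<in>B. a \<bullet> b > 0"
      using sep unfolding separable_def by auto
    obtain M where M: "M > 0" "a \<bullet> x0 + M * (h \<bullet> x0) > 0"
      using exists_large_multiple[of "{x0}" "\<lambda>x. h \<bullet> x" "\<lambda>x. a \<bullet> x"] x0 by auto
    have "\<forall>b\<in>insert x0 B. (a + M *\<^sub>R h) \<bullet> b > 0"
    proof
      fix b assume b: "b \<in> insert x0 B"
      show "(a + M *\<^sub>R h) \<bullet> b > 0"
      proof (cases "b = x0")
        case True
        then show ?thesis using M by (simp add: inner_add_left)
      next
        case False
        then have "a \<bullet> b > 0" "M * (h \<bullet> b) \<ge> 0"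
          using b a B X M by auto
        then show ?thesis by (simp add: inner_add_left)
      qed
    qed
    moreover have "\<forall>d\<in>D. (a + M *\<^sub>R h) \<bullet> d = 0"
      using a D by (simp add: inner_add_left)
    ultimately show ?thesis unfolding separable_def by blast
  qed
  moreover have "separable D B" if "separable D (insert x0 B)"
    using that unfolding separable_def by auto
  ultimately show "of_bool (separable D (insert x0 B)) = (of_bool (separable D B) :: real)"
    by auto
qed

text \<open>
  Rescaling the functional turns the strict conditions into closed ones with prescribed bounds,
  to which the exchange of states can be applied.
\<close>

lemma separable_scaled:
  assumes "finite B"
  shows "separable D (insert y B) \<longleftrightarrow>
    (\<exists>a. (\<forall>d\<in>D. a \<bullet> d = 0) \<and> a \<bullet> y \<ge> c \<and> a \<bullet> y > 0 \<and> (\<forall>b\<in>B. a \<bullet> b \<ge> 1))"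
proof
  assume "separable D (insert y B)"
  then obtain a where a: "\<forall>d\<in>D. a \<bullet> d = 0" "\<forall>b\<in>insert y B. a \<bullet> b > 0"
    unfolding separable_def by blast
  obtain M where M: "M > 0" "\<forall>b\<in>insert y B. - (\<bar>c\<bar> + 1) + M * (a \<bullet> b) > 0"
    using exists_large_multiple[of "insert y B" "\<lambda>b. a \<bullet> b" "\<lambda>_. - (\<bar>c\<bar> + 1)"] assms a by auto
  show "\<exists>a. (\<forall>d\<in>D. a \<bullet> d = 0) \<and> a \<bullet> y \<ge> c \<and> a \<bullet> y > 0 \<and> (\<forall>b\<in>B. a \<bullet> b \<ge> 1)"
  proof (intro exI[of _ "M *\<^sub>R a"] conjI ballI)
    show "(M *\<^sub>R a) \<bullet> b \<ge> 1" if "b \<in> B" for b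
      using M(2) that by (simp; smt (verit))
  qed (use a M in \<open>auto; smt (verit)\<close>)+
next
  assume "\<exists>a. (\<forall>d\<in>D. a \<bullet> d = 0) \<and> a \<bullet> y \<ge> c \<and> a \<bullet> y > 0 \<and> (\<forall>b\<in>B. a \<bullet> b \<ge> 1)"
  then show "separable D (insert y B)"
    unfolding separable_def by (smt (verit) insert_iff)
qed

text \<open>
  A form of the Farkas lemma: the hypothesis says that \<open>y\<close> lies in the closed cone generated by
  \<open>X\<close> and the span of \<open>D\<close>, and a nonnegative representation of \<open>y\<close> bounds the functional.
\<close>

lemma finite_cone_bounded_functional:
  fixes y :: "'a::euclidean_space"
  assumes "finite X" "finite D"
    and dual: "\<And>h. \<forall>d\<in>D. h \<bullet> d = 0 \<Longrightarrow> \<forall>x\<in>X. h \<bullet> x \<le> 0 \<Longrightarrow> h \<bullet> y \<le> 0"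
  obtains c where "\<And>a. \<forall>d\<in>D. a \<bullet> d = 0 \<Longrightarrow> \<forall>x\<in>X. a \<bullet> x \<le> 1 \<Longrightarrow> a \<bullet> y \<le> c"
proof -
  define K where "K = convex_cone hull (X \<union> D \<union> uminus ` D)"
  have "y \<in> K"
  proof (rule ccontr)
    assume y: "y \<notin> K"
    have "convex K" "closed K"
      using assms by (simp_all add: K_def convex_convex_cone_hull closed_convex_cone_hull)
    from separating_hyperplane_closed_point[OF this y]
    obtain a b where ab: "a \<bullet> y < b" "\<forall>x\<in>K. a \<bullet> x > b" by blast
    have b: "b < 0"
      using ab(2) convex_cone_hull_contains_0 by (force simp: K_def)
    have pos: "a \<bullet> x \<ge> 0" if "x \<in> K" for x
    proof (rule ccontr)
      assume neg: "\<not> a \<bullet> x \<ge> 0"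
      have "(b / (a \<bullet> x)) *\<^sub>R x \<in> K"
        using that neg b unfolding K_def
        by (intro convex_cone_hull_mul) (auto simp: divide_nonpos_neg)
      then show False
        using ab(2) neg by fastforce
    qed
    have gen: "x \<in> K" if "x \<in> X \<union> D \<union> uminus ` D" for x
      using that by (simp add: K_def hull_inc)
    have "(- a) \<bullet> y \<le> 0"
    proof (rule dual)
      show "\<forall>d\<in>D. (- a) \<bullet> d = 0"
      proof
        fix d assume "d \<in> D"
        then have "a \<bullet> d \<ge> 0" "a \<bullet> (- d) \<ge> 0"
          using gen pos by blast+
        then show "(- a) \<bullet> d = 0" by simp
      qed
      show "\<forall>x\<in>X. (- a) \<bullet> x \<le> 0"
        using gen pos by simp
    qed
    then show False
      using ab(1) b by simp
  qed
  moreover have "K \<subseteq> {z. \<exists>c. \<forall>a. (\<forall>d\<in>D. a \<bullet> d = 0) \<longrightarrow> (\<forall>x\<in>X. a \<bullet> x \<le> 1) \<longrightarrow> a \<bullet> z \<le> c}" (is "_ \<subseteq> ?B")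
    unfolding K_def
  proof (rule hull_minimal)
    show "X \<union> D \<union> uminus ` D \<subseteq> ?B"
      by (auto intro!: exI[of _ 1])
    have "x + z \<in> ?B" if xz: "x \<in> ?B" "z \<in> ?B" for x z
    proof -
      obtain c c' where
        "\<forall>a. (\<forall>d\<in>D. a \<bullet> d = 0) \<longrightarrow> (\<forall>x\<in>X. a \<bullet> x \<le> 1) \<longrightarrow> a \<bullet> x \<le> c"
        "\<forall>a. (\<forall>d\<in>D. a \<bullet> d = 0) \<longrightarrow> (\<forall>x\<in>X. a \<bullet> x \<le> 1) \<longrightarrow> a \<bullet> z \<le> c'"
        using xz by blast
      then have "\<forall>a. (\<forall>d\<in>D. a \<bullet> d = 0) \<longrightarrow> (\<forall>x\<in>X. a \<bullet> x \<le> 1) \<longrightarrow> a \<bullet> (x + z) \<le> c + c'"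
        by (simp add: add_mono inner_add_right)
      then show ?thesis by blast
    qed
    moreover have "t *\<^sub>R x \<in> ?B" if x: "x \<in> ?B" and t: "t \<ge> 0" for x t
    proof -
      obtain c where
        "\<forall>a. (\<forall>d\<in>D. a \<bullet> d = 0) \<longrightarrow> (\<forall>x\<in>X. a \<bullet> x \<le> 1) \<longrightarrow> a \<bullet> x \<le> c"
        using x by blast
      then have "\<forall>a. (\<forall>d\<in>D. a \<bullet> d = 0) \<longrightarrow> (\<forall>x\<in>X. a \<bullet> x \<le> 1) \<longrightarrow> a \<bullet> (t *\<^sub>R x) \<le> t * c"
        using t by (simp add: mult_left_mono)
      then show ?thesis by blast
    qed
    moreover have "0 \<in> ?B" by auto
    ultimately show "convex_cone ?B"
      unfolding convex_cone_iff by blast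
  qed
  ultimately show ?thesis
    using that by blast
qed

lemma convex_crossing:
  fixes x y :: "'a::euclidean_space"
  assumes "convex C" "x \<in> C" "a \<bullet> x \<le> c" "y \<in> C" "a \<bullet> y \<ge> c"
  obtains z where "z \<in> C" "a \<bullet> z = c"
  using connected_ivt_hyperplane[OF convex_connected[OF assms(1)] assms(2,4,3,5)] by blast

lemma convex_inner_vimage:
  assumes "convex S"
  shows "convex {a::'a::euclidean_space. a \<bullet> b \<in> S}"
proof -
  have "linear (\<lambda>a. a \<bullet> b)"
    by (simp add: linear_iff inner_add_left)
  from convex_linear_vimage[OF this assms] show ?thesis
    by (simp add: vimage_def)
qed

text \<open>
  Exchanging the states \<open>[1, \<infinity>)\<close> and \<open>\<real>\<close> with \<open>{1}\<close> and \<open>(-\<infinity>, 1]\<close> turns the sum into one over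
  functionals that are at most \<open>1\<close> on \<open>X\<close> and at least \<open>c\<close> at \<open>y\<close>. If \<open>y\<close> is in the cone generated
  by \<open>X\<close> modulo \<open>D\<close>, there are none for large \<open>c\<close>.
\<close>

lemma alternating_sum_separable_cone:
  fixes y :: "'a::euclidean_space"
  assumes "finite X" "finite D"
    and dual: "\<And>h. \<forall>d\<in>D. h \<bullet> d = 0 \<Longrightarrow> \<forall>x\<in>X. h \<bullet> x \<le> 0 \<Longrightarrow> h \<bullet> y \<le> 0"
  shows "alternating_sum X (\<lambda>B. of_bool (separable D (insert y B))) = 0"
proof -
  obtain c0 where c0: "\<And>a. \<forall>d\<in>D. a \<bullet> d = 0 \<Longrightarrow> \<forall>x\<in>X. a \<bullet> x \<le> 1 \<Longrightarrow> a \<bullet> y \<le> c0"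
    using finite_cone_bounded_functional[OF assms] by blast
  define c where "c = \<bar>c0\<bar> + 1"
  define E where "E s a \<longleftrightarrow> (\<forall>d\<in>D. a \<bullet> d = 0) \<and> a \<bullet> y \<ge> c \<and> (\<forall>b\<in>X. a \<bullet> b \<in> s b)"
    for s and a :: 'a
  define F where "F s = (of_bool (\<exists>a. E s a) :: real)" for s
  have F_cut: "F (s(l := UNIV)) - F (s(l := {1..})) = F (s(l := {..1})) - F (s(l := {1}))"
    if s: "range s \<subseteq> Collect convex" and l: "l \<in> X" for s l
  proof -
    have E_upd: "E (s(l := T)) a \<longleftrightarrow> E (s(l := UNIV)) a \<and> a \<bullet> l \<in> T" for T a
      unfolding E_def using l by auto
    have "convex {a. E (s(l := UNIV)) a}"
    proof -
      have "{a. E (s(l := UNIV)) a} = (\<Inter>d\<in>D. {a. a \<bullet> d \<in> {0}}) \<inter> {a. a \<bullet> y \<in> {c..}}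
        \<inter> (\<Inter>b\<in>X. {a. a \<bullet> b \<in> (s(l := UNIV)) b})"
        unfolding E_def by (auto split: if_splits)
      moreover have "convex ((s(l := UNIV)) b)" for b
        using s by auto
      ultimately show ?thesis
        by (simp only:) (intro convex_Int convex_INT convex_inner_vimage; simp)
    qed
    then have "\<exists>a. E (s(l := {1})) a"
      if "E (s(l := {1..})) a" "E (s(l := {..1})) a'" for a a'
      using convex_crossing[of "{a. E (s(l := UNIV)) a}" a' l 1 a] that
      unfolding E_upd[of "{1}"] E_upd[of "{1..}"] E_upd[of "{..1}"]
      by (simp add: inner_commute) metis
    moreover have "E (s(l := {1})) a \<longleftrightarrow> E (s(l := {1..})) a \<and> E (s(l := {..1})) a" for a
      unfolding E_upd[of "{1}"] E_upd[of "{1..}"] E_upd[of "{..1}"] by auto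
    moreover have "E (s(l := UNIV)) a \<longleftrightarrow> E (s(l := {1..})) a \<or> E (s(l := {..1})) a" for a
      unfolding E_upd[of "{1..}"] E_upd[of "{..1}"] by auto
    ultimately show ?thesis
      unfolding F_def by (auto simp: of_bool_def)
  qed
  have "alternating_sum X (\<lambda>B. of_bool (separable D (insert y B)))
    = alternating_sum X (\<lambda>J. F (\<lambda>l. if l \<in> J then {1..} else if l \<in> X then UNIV else UNIV))"
  proof (rule alternating_sum_cong)
    fix B assume B: "B \<subseteq> X"
    then have finB: "finite B" using assms(1) finite_subset by blast
    have "separable D (insert y B) \<longleftrightarrow>
      (\<exists>a. E (\<lambda>l. if l \<in> B then {1..} else if l \<in> X then UNIV else UNIV) a)"
      unfolding separable_scaled[OF finB, of D y c] E_def
      by (rule arg_cong[of _ _ Ex], rule ext) (use B in \<open>auto simp: c_def\<close>)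
    then show "of_bool (separable D (insert y B))
      = F (\<lambda>l. if l \<in> B then {1..} else if l \<in> X then UNIV else UNIV)"
      by (simp add: F_def)
  qed
  also have "\<dots> = alternating_sum X
      (\<lambda>J. F (\<lambda>l. if l \<in> J then {1} else if l \<in> X then {..1} else UNIV))"
    by (rule alternating_sum_exchange[where S = "Collect convex", OF assms(1) F_cut]) auto
  also have "\<dots> = alternating_sum X (\<lambda>J. 0)"
  proof (rule alternating_sum_cong)
    fix J assume "J \<subseteq> X"
    have "\<not> E (\<lambda>l. if l \<in> J then {1} else if l \<in> X then {..1} else UNIV) a" for a
    proof
      assume a: "E (\<lambda>l. if l \<in> J then {1} else if l \<in> X then {..1} else UNIV) a"
      have "\<forall>x\<in>X. a \<bullet> x \<le> 1"
        using a unfolding E_def by (auto split: if_splits)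
      then have "a \<bullet> y \<le> c0" using c0 a unfolding E_def by blast
      then show False using a unfolding E_def c_def by linarith
    qed
    then show "F (\<lambda>l. if l \<in> J then {1} else if l \<in> X then {..1} else UNIV) = 0"
      unfolding F_def by simp
  qed
  finally show ?thesis by simp
qed

text \<open>
  The functionals that are positive on \<open>B\<close> form a convex cone \<open>C\<close>, open in the orthogonal
  complement of \<open>D\<close>. If the hyperplane orthogonal to \<open>x\<close> meets \<open>C\<close>, then a small shift along \<open>a0\<close> or
  \<open>- a0\<close> shows that so do both of its open sides; if it does not, then \<open>C\<close> lies on one side or is empty.
\<close>

lemma separable_insert_opposite:
  assumes "finite B" "a0 \<bullet> x \<noteq> 0" "\<forall>d\<in>D. a0 \<bullet> d = 0"
  shows "(of_bool (separable D (insert x B)) + of_bool (separable D (insert (- x) B)) :: real)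
    = of_bool (separable D B) + of_bool (separable (insert x D) B)"
proof -
  define C where "C = {a. (\<forall>d\<in>D. a \<bullet> d = 0) \<and> (\<forall>b\<in>B. a \<bullet> b > 0)}"
  have "convex C"
  proof -
    have "C = (\<Inter>d\<in>D. {a. a \<bullet> d \<in> {0}}) \<inter> (\<Inter>b\<in>B. {a. a \<bullet> b \<in> {0<..}})"
      unfolding C_def by auto
    then show ?thesis
      by (simp only:) (intro convex_Int convex_INT convex_inner_vimage; simp)
  qed
  then have mid: "\<exists>a\<in>C. a \<bullet> x = 0" if "a1 \<in> C" "a1 \<bullet> x > 0" "a2 \<in> C" "- (a2 \<bullet> x) > 0" for a1 a2
    using convex_crossing[of C a2 x 0 a1] that by (auto simp: inner_commute)
  have move: "\<exists>a'\<in>C. a' \<bullet> x > 0" "\<exists>a'\<in>C. - (a' \<bullet> x) > 0" if a: "a \<in> C" "a \<bullet> x = 0" for a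
  proof -
    have *: "\<exists>a'\<in>C. a' \<bullet> x = M * (a \<bullet> x) + e * (a0 \<bullet> x)" if e: "e \<in> {1, - 1}"
      and M: "\<forall>b\<in>B. e * (a0 \<bullet> b) + M * (a \<bullet> b) > 0" for e M
      using a assms(3) M
      by (intro bexI[of _ "M *\<^sub>R a + e *\<^sub>R a0"]) (auto simp: C_def inner_add_left add.commute)
    have **: "\<exists>M. \<forall>b\<in>B. e * (a0 \<bullet> b) + M * (a \<bullet> b) > 0" for e
      using exists_large_multiple[OF assms(1), of "\<lambda>b. a \<bullet> b" "\<lambda>b. e * (a0 \<bullet> b)"] a
      by (auto simp: C_def)
    have "\<exists>a'\<in>C. a' \<bullet> x = e * (a0 \<bullet> x)" if "e \<in> {1, - 1}" for e
      using *[OF that] ** a by (metis mult_zero_right add_0)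
    from this[of 1] this[of "- 1"] show "\<exists>a'\<in>C. a' \<bullet> x > 0" "\<exists>a'\<in>C. - (a' \<bullet> x) > 0"
      using assms(2) by (auto simp: neg_less_0_iff_less not_less) (metis linorder_neqE_linordered_idom neg_0_less_iff_less neg_less_0_iff_less)+
  qed
  have "separable D (insert x B) \<longleftrightarrow> (\<exists>a\<in>C. a \<bullet> x > 0)"
    "separable D (insert (- x) B) \<longleftrightarrow> (\<exists>a\<in>C. - (a \<bullet> x) > 0)"
    "separable D B \<longleftrightarrow> (\<exists>a. a \<in> C)"
    "separable (insert x D) B \<longleftrightarrow> (\<exists>a\<in>C. a \<bullet> x = 0)"
    unfolding separable_def C_def by auto
  then show ?thesis
    using mid move by (auto simp: of_bool_def) (smt (verit))+
qed

text \<open>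
  The hypothesis says that \<open>X\<close> generates a linear subspace modulo the span of \<open>D\<close> as a cone, and the exponent
  has the parity of the dimension of this subspace; it is a local form of the Euler relation. Removing
  an \<open>x\<close> outside the span of \<open>D\<close> replaces \<open>X\<close> by \<open>X - {x}\<close> and \<open>D\<close> by \<open>insert x D\<close> at the cost of
  a sign, because the term of \<open>- x\<close> in \<open>separable_insert_opposite\<close> contributes \<open>0\<close>: modulo \<open>D\<close>,
  the vector \<open>- x\<close> lies in the cone generated by the rest.
\<close>

lemma alternating_sum_separable:
  fixes X D :: "'a::euclidean_space set"
  assumes "finite X" "finite D"
    and "\<And>h. \<forall>d\<in>D. h \<bullet> d = 0 \<Longrightarrow> \<forall>x\<in>X. h \<bullet> x \<ge> 0 \<Longrightarrow> \<forall>x\<in>X. h \<bullet> x = 0"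
  shows "alternating_sum X (\<lambda>B. of_bool (separable D B)) = (- 1) ^ (dim (X \<union> D) + dim D)"
  using assms
proof (induction "card X" arbitrary: X D)
  case 0
  then have "X = {}" by simp
  then show ?case
    by (simp add: separable_def) (metis inner_zero_left)
next
  case (Suc k)
  show ?case
  proof (cases "X \<subseteq> span D")
    case True
    then obtain x where x: "x \<in> X" using Suc.hyps by fastforce
    have dimeq: "dim (X \<union> D) = dim D"
      using True by (metis Un_least Un_upper2 dim_span dim_subset dual_order.antisym span_superset)
    have "alternating_sum X (\<lambda>B. of_bool (separable D B))
      = (\<Sum>B\<in>{{}}. (- 1) ^ card B * of_bool (separable D B))"
      unfolding alternating_sum_def
    proof (rule sum.mono_neutral_right)
      show "\<forall>B\<in>Pow X - {{}}. (- 1) ^ card B * (of_bool (separable D B) :: real) = 0"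
      proof
        fix B assume "B \<in> Pow X - {{}}"
        then obtain b where b: "b \<in> B" "b \<in> span D" using True by blast
        have "a \<bullet> b = 0" if "\<forall>d\<in>D. a \<bullet> d = 0" for a
          using orthogonal_to_span[OF b(2), of a] that by (simp add: orthogonal_def)
        then show "(- 1) ^ card B * (of_bool (separable D B) :: real) = 0"
          using b by (force simp: separable_def)
      qed
    qed (use Suc in auto)
    also have "\<dots> = 1"
      by (simp add: separable_def) (metis inner_zero_left)
    finally have "alternating_sum X (\<lambda>B. of_bool (separable D B)) = 1" .
    then show ?thesis by (simp add: dimeq)
  next
    case False
    then obtain x where x: "x \<in> X" "x \<notin> span D" by blast
    define X' where "X' = X - {x}"
    have X': "finite X'" "x \<notin> X'" "X = insert x X'" "k = card X'"
      using x Suc by (auto simp: X'_def)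
    obtain a0 where a0: "\<forall>d\<in>D. a0 \<bullet> d = 0" "a0 \<bullet> x \<noteq> 0"
    proof -
      obtain u z where uz: "u \<in> span D" "\<And>w. w \<in> span D \<Longrightarrow> orthogonal z w" "x = u + z"
        using orthogonal_subspace_decomp_exists[of D x] by metis
      have "z \<bullet> x = z \<bullet> z"
        using uz(2)[OF uz(1)] uz(3) by (simp add: inner_add_right orthogonal_def)
      moreover have "z \<noteq> 0" using uz x by auto
      ultimately show ?thesis
        using that[of z] uz(2) by (auto simp: orthogonal_def span_base)
    qed
    let ?e = "\<lambda>D. alternating_sum X' (\<lambda>B. of_bool (separable D B))"
    let ?s = "\<lambda>y. alternating_sum X' (\<lambda>B. of_bool (separable D (insert y B)))"
    have "?s (- x) = 0"
    proof (rule alternating_sum_separable_cone)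
      fix h assume h: "\<forall>d\<in>D. h \<bullet> d = 0" "\<forall>x\<in>X'. h \<bullet> x \<le> 0"
      show "h \<bullet> (- x) \<le> 0"
      proof (rule ccontr)
        assume "\<not> h \<bullet> (- x) \<le> 0"
        then have "\<forall>x\<in>X. (- h) \<bullet> x = 0"
          using Suc.prems(3)[of "- h"] h by (auto simp: X')
        then show False using \<open>\<not> h \<bullet> (- x) \<le> 0\<close> x by simp
      qed
    qed (use X' Suc in auto)
    moreover have "?s x + ?s (- x) = ?e D + ?e (insert x D)"
      unfolding alternating_sum_add[symmetric]
    proof (rule alternating_sum_cong)
      fix B assume "B \<subseteq> X'"
      then have "finite B" using X' finite_subset by blast
      then show "(of_bool (separable D (insert x B)) + of_bool (separable D (insert (- x) B)) :: real)
        = of_bool (separable D B) + of_bool (separable (insert x D) B)"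
        using separable_insert_opposite[of B a0 x D] a0 by auto
    qed
    moreover have "alternating_sum X (\<lambda>B. of_bool (separable D B)) = ?e D - ?s x"
      unfolding X'(3) by (rule alternating_sum_insert) (use X' in auto)
    moreover have "X' \<union> insert x D = X \<union> D" by (simp add: X')
    moreover have "dim (insert x D) = dim D + 1"
      using x by (simp add: dim_insert)
    moreover have "?e (insert x D) = (- 1) ^ (dim (X' \<union> insert x D) + dim (insert x D))"
    proof (rule Suc.hyps(1)[OF X'(4)])
      fix h assume h: "\<forall>d\<in>insert x D. h \<bullet> d = 0" "\<forall>x\<in>X'. 0 \<le> h \<bullet> x"
      then have "\<forall>x\<in>X. h \<bullet> x = 0"
        by (intro Suc.prems(3)) (auto simp: X')
      then show "\<forall>x\<in>X'. h \<bullet> x = 0" by (simp add: X')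
    qed (use X' Suc in auto)
    ultimately show ?thesis
      by simp
  qed
qed

section \<open>Faces in terms of generators\<close>

text \<open>
  If \<open>V\<close> is finite, the exposed subsets of \<open>V\<close> are the intersections of \<open>V\<close> with the faces of its
  convex hull; taking \<open>a = 0\<close> yields \<open>V\<close> itself.
\<close>

definition exposed_subset :: "'a::euclidean_space set \<Rightarrow> 'a set \<Rightarrow> bool"
  where "exposed_subset W V \<longleftrightarrow>
    W \<subseteq> V \<and> (\<exists>a c. (\<forall>w\<in>W. a \<bullet> w = c) \<and> (\<forall>v\<in>V - W. a \<bullet> v > c))"

text \<open>
  For finite \<open>V\<close>, this says that \<open>W\<close> lies in no proper face of the convex hull of \<open>V\<close>.
\<close>

definition spanning_subset :: "'a::euclidean_space set \<Rightarrow> 'a set \<Rightarrow> bool"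
  where "spanning_subset W V \<longleftrightarrow>
    W \<subseteq> V \<and> (\<forall>a c. (\<forall>w\<in>W. a \<bullet> w = c) \<longrightarrow> (\<forall>v\<in>V. a \<bullet> v \<ge> c) \<longrightarrow> (\<forall>v\<in>V. a \<bullet> v = c))"

lemma face_of_convex_hull_generators:
  fixes U :: "'a::euclidean_space set"
  assumes "finite U" "F face_of convex hull U"
  shows "convex hull (U \<inter> F) = F"
proof -
  obtain S where S: "S \<subseteq> U" "F = convex hull S"
    using face_of_convex_hull_subset[OF finite_imp_compact[OF assms(1)] assms(2)] by metis
  have "F \<subseteq> convex hull (U \<inter> F)"
    unfolding S(2) using S(1) by (intro hull_mono) (auto simp: hull_inc)
  moreover have "convex hull (U \<inter> F) \<subseteq> F"
    using S(2) by (intro hull_minimal) auto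
  ultimately show ?thesis by blast
qed

lemma exposed_subset_face:
  assumes "finite U" "exposed_subset W U"
  shows "convex hull W face_of convex hull U" "U \<inter> convex hull W = W"
proof -
  obtain a c where ac: "W \<subseteq> U" "\<forall>w\<in>W. a \<bullet> w = c" "\<forall>v\<in>U - W. a \<bullet> v > c"
    using assms(2) unfolding exposed_subset_def by blast
  have "U \<subseteq> {x. a \<bullet> x \<ge> c}"
    using ac by force
  then have ge: "convex hull U \<subseteq> {x. a \<bullet> x \<ge> c}"
    by (intro hull_minimal convex_halfspace_ge)
  let ?F = "convex hull U \<inter> {x. a \<bullet> x = c}"
  have F: "?F face_of convex hull U"
    using ge by (intro face_of_Int_supporting_hyperplane_ge) auto
  have "U \<inter> ?F = W"
    using ac hull_inc[of _ U convex] by force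
  with face_of_convex_hull_generators[OF assms(1) F]
  show "convex hull W face_of convex hull U" "U \<inter> convex hull W = W"
    using F by auto
qed

lemma face_exposed_subset:
  fixes U :: "'a::euclidean_space set"
  assumes "finite U" "F face_of convex hull U"
  shows "exposed_subset (U \<inter> F) U"
proof -
  have "F exposed_face_of convex hull U"
    using assms exposed_face_of_polyhedron polyhedron_convex_hull by blast
  then obtain a b where ab: "convex hull U \<subseteq> {x. a \<bullet> x \<le> b}" "F = convex hull U \<inter> {x. a \<bullet> x = b}"
    unfolding exposed_face_of_def by blast
  have "(\<forall>w\<in>U \<inter> F. (- a) \<bullet> w = - b) \<and> (\<forall>v\<in>U - U \<inter> F. (- a) \<bullet> v > - b)"
  proof (intro conjI ballI)
    fix v assume v: "v \<in> U - U \<inter> F"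
    then have "v \<in> convex hull U" by (simp add: hull_inc)
    then show "(- a) \<bullet> v > - b"
      using v ab by (auto simp: order_less_le)
  qed (use ab in auto)
  then show ?thesis
    unfolding exposed_subset_def by blast
qed

lemma sum_faces_eq_sum_exposed_subsets:
  fixes U :: "'a::euclidean_space set"
  assumes "finite U"
  shows "(\<Sum>F | F face_of convex hull U \<and> F \<noteq> {}. g F)
    = (\<Sum>W | exposed_subset W U \<and> W \<noteq> {}. g (convex hull W))"
proof (rule sum.reindex_bij_witness[of _ "\<lambda>W. convex hull W" "\<lambda>F. U \<inter> F"])
  fix F assume "F \<in> {F. F face_of convex hull U \<and> F \<noteq> {}}"
  then have F: "F face_of convex hull U" "F \<noteq> {}" by auto
  note gen = face_of_convex_hull_generators[OF assms F(1)]
  show "convex hull (U \<inter> F) = F" by (rule gen)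
  show "U \<inter> F \<in> {W. exposed_subset W U \<and> W \<noteq> {}}"
    using face_exposed_subset[OF assms F(1)] gen F(2) by auto
  show "g (convex hull (U \<inter> F)) = g F" by (simp add: gen)
next
  fix W assume "W \<in> {W. exposed_subset W U \<and> W \<noteq> {}}"
  then show "U \<inter> convex hull W = W" "convex hull W \<in> {F. F face_of convex hull U \<and> F \<noteq> {}}"
    using exposed_subset_face[OF assms] by auto
qed

lemma exposed_subset_Un_iff:
  assumes "w0 \<in> W" "B \<inter> W = {}"
  shows "exposed_subset W (W \<union> B) \<longleftrightarrow> separable ((\<lambda>w. w - w0) ` W) ((\<lambda>b. b - w0) ` B)"
proof -
  have "W \<union> B - W = B" using assms(2) by blast
  moreover have "(\<exists>c. (\<forall>w\<in>W. a \<bullet> w = c) \<and> (\<forall>v\<in>B. a \<bullet> v > c))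
    \<longleftrightarrow> (\<forall>w\<in>W. a \<bullet> w = a \<bullet> w0) \<and> (\<forall>v\<in>B. a \<bullet> v > a \<bullet> w0)" for a
  proof
    assume "\<exists>c. (\<forall>w\<in>W. a \<bullet> w = c) \<and> (\<forall>v\<in>B. a \<bullet> v > c)"
    then obtain c where c: "\<forall>w\<in>W. a \<bullet> w = c" "\<forall>v\<in>B. a \<bullet> v > c" by blast
    then have "a \<bullet> w0 = c" using assms(1) by simp
    with c show "(\<forall>w\<in>W. a \<bullet> w = a \<bullet> w0) \<and> (\<forall>v\<in>B. a \<bullet> v > a \<bullet> w0)" by simp
  qed blast
  ultimately show ?thesis
    unfolding exposed_subset_def separable_def by (simp add: inner_diff_right)
qed

text \<open>
  With a point \<open>w0\<close> of \<open>W\<close> as origin, \<open>W\<close> is an exposed subset of \<open>W \<union> B\<close> if and only if \<open>B\<close> is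
  separable modulo the directions of \<open>W\<close>, so the two counts of separable sets apply.
\<close>

lemma alternating_sum_exposed:
  assumes V: "finite V" "W \<subseteq> V" and "w0 \<in> W"
  shows "alternating_sum (V - W) (\<lambda>B. of_bool (exposed_subset W (W \<union> B)))
    = (if spanning_subset W V then (- 1) ^ (nat (aff_dim V) + nat (aff_dim W)) else 0)"
proof -
  define D where "D = (\<lambda>w. w - w0) ` W"
  define X where "X = (\<lambda>b. b - w0) ` (V - W)"
  have fin: "finite D" "finite X"
    using V finite_subset by (auto simp: D_def X_def)
  have "alternating_sum (V - W) (\<lambda>B. of_bool (exposed_subset W (W \<union> B)))
    = alternating_sum (V - W) (\<lambda>B. of_bool (separable D ((\<lambda>b. b - w0) ` B)))"
  proof (rule alternating_sum_cong)
    fix B assume "B \<subseteq> V - W"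
    then have "B \<inter> W = {}" by blast
    then show "of_bool (exposed_subset W (W \<union> B)) = of_bool (separable D ((\<lambda>b. b - w0) ` B))"
      using exposed_subset_Un_iff[OF assms(3)] unfolding D_def by simp
  qed
  also have "\<dots> = alternating_sum X (\<lambda>B. of_bool (separable D B))"
    unfolding X_def by (rule alternating_sum_reindex[symmetric]) (simp add: inj_on_def)
  also have "\<dots> = (if spanning_subset W V then (- 1) ^ (nat (aff_dim V) + nat (aff_dim W)) else 0)"
  proof (cases "spanning_subset W V")
    case True
    have "X \<union> D = (\<lambda>v. v - w0) ` V"
      using V by (auto simp: X_def D_def)
    then have dims: "dim (X \<union> D) = nat (aff_dim V)" "dim D = nat (aff_dim W)"
      using aff_dim_eq_dim_subtract[of w0 V] aff_dim_eq_dim_subtract[of w0 W] assms(3)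
        subsetD[OF assms(2,3)]
      by (simp_all add: D_def hull_inc)
    have "alternating_sum X (\<lambda>B. of_bool (separable D B)) = (- 1) ^ (dim (X \<union> D) + dim D)"
    proof (rule alternating_sum_separable[OF fin(2,1)])
      fix h assume h: "\<forall>d\<in>D. h \<bullet> d = 0" "\<forall>x\<in>X. 0 \<le> h \<bullet> x"
      have W0: "\<forall>w\<in>W. h \<bullet> w = h \<bullet> w0" and "\<forall>v\<in>V - W. h \<bullet> v \<ge> h \<bullet> w0"
        using h by (auto simp: D_def X_def inner_diff_right)
      then have "\<forall>v\<in>V. h \<bullet> v \<ge> h \<bullet> w0"
        by (metis Diff_iff order_refl)
      with W0 have "\<forall>v\<in>V. h \<bullet> v = h \<bullet> w0"
        using True unfolding spanning_subset_def by blast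
      then show "\<forall>x\<in>X. h \<bullet> x = 0" by (auto simp: X_def inner_diff_right)
    qed
    then show ?thesis using True dims by simp
  next
    case False
    then obtain a c v where ac: "\<forall>w\<in>W. a \<bullet> w = c" "\<forall>v\<in>V. a \<bullet> v \<ge> c" "v \<in> V" "a \<bullet> v \<noteq> c"
      using V unfolding spanning_subset_def by blast
    then have c: "c = a \<bullet> w0" using assms(3) by auto
    have "alternating_sum X (\<lambda>B. of_bool (separable D B)) = 0"
    proof (rule alternating_sum_separable_eq_0[OF fin(2)])
      show "\<forall>d\<in>D. a \<bullet> d = 0" "\<forall>x\<in>X. a \<bullet> x \<ge> 0"
        using ac c by (auto simp: D_def X_def inner_diff_right)
      show "v - w0 \<in> X" using ac by (auto simp: X_def)
      show "a \<bullet> (v - w0) > 0" using ac c by (auto simp: inner_diff_right order_less_le)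
    qed
    then show ?thesis using False by simp
  qed
  finally show ?thesis .
qed

text \<open>
  Interchange the sums over hulls and over their faces. The sets \<open>U\<close> with \<open>W\<close> as an exposed subset
  are the \<open>W \<union> B\<close> counted in \<open>alternating_sum_exposed\<close>; the sign \<open>(-1) ^ dim W\<close> occurs twice and cancels.
\<close>

lemma alternating_sum_face_sums:
  assumes "finite V"
  shows "alternating_sum V
      (\<lambda>U. \<Sum>W | exposed_subset W U \<and> W \<noteq> {}. (- 1) ^ nat (aff_dim W) * f W)
    = (- 1) ^ nat (aff_dim V) *
      alternating_sum V (\<lambda>W. of_bool (spanning_subset W V \<and> W \<noteq> {}) * f W)"
proof -
  let ?d = "\<lambda>W. nat (aff_dim W)"
  have "alternating_sum V (\<lambda>U. \<Sum>W | exposed_subset W U \<and> W \<noteq> {}. (- 1) ^ ?d W * f W)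
    = alternating_sum V (\<lambda>U. \<Sum>W\<in>Pow V - {{}}. (- 1) ^ ?d W * f W * of_bool (exposed_subset W U))"
  proof (rule alternating_sum_cong)
    fix U assume "U \<subseteq> V"
    then have sub: "{W. exposed_subset W U \<and> W \<noteq> {}} \<subseteq> Pow V - {{}}"
      by (auto simp: exposed_subset_def)
    show "(\<Sum>W | exposed_subset W U \<and> W \<noteq> {}. (- 1) ^ ?d W * f W)
      = (\<Sum>W\<in>Pow V - {{}}. (- 1) ^ ?d W * f W * of_bool (exposed_subset W U))"
      by (rule sum.mono_neutral_cong_left) (use sub assms in auto)
  qed
  also have "\<dots> = (\<Sum>W\<in>Pow V - {{}}. (- 1) ^ ?d W * f W *
      alternating_sum V (\<lambda>U. of_bool (exposed_subset W U)))"
    unfolding alternating_sum_sum alternating_sum_cmult ..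
  also have "\<dots> = (\<Sum>W\<in>Pow V - {{}}. (- 1) ^ ?d V *
      ((- 1) ^ card W * (of_bool (spanning_subset W V) * f W)))"
  proof (rule sum.cong[OF refl])
    fix W assume "W \<in> Pow V - {{}}"
    then obtain w0 where W: "W \<subseteq> V" "w0 \<in> W" by blast
    have finW: "finite W" using W assms finite_subset by blast
    have "alternating_sum V (\<lambda>U. of_bool (exposed_subset W U))
      = (\<Sum>U\<in>(\<lambda>B. W \<union> B) ` Pow (V - W). (- 1) ^ card U * of_bool (exposed_subset W U))"
      unfolding alternating_sum_def
    proof (rule sum.mono_neutral_right)
      show "\<forall>U\<in>Pow V - (\<union>) W ` Pow (V - W). (- 1) ^ card U * (of_bool (exposed_subset W U) :: real) = 0"
      proof
        fix U assume U: "U \<in> Pow V - (\<union>) W ` Pow (V - W)"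
        have "\<not> W \<subseteq> U"
        proof
          assume "W \<subseteq> U"
          then have "U = W \<union> (U - W)" by blast
          with U show False by blast
        qed
        then show "(- 1) ^ card U * (of_bool (exposed_subset W U) :: real) = 0"
          by (simp add: exposed_subset_def)
      qed
    qed (use assms W in auto)
    also have "\<dots> = (\<Sum>B\<in>Pow (V - W). (- 1) ^ card (W \<union> B) * of_bool (exposed_subset W (W \<union> B)))"
      by (rule sum.reindex[unfolded o_def]) (rule inj_on_inverseI[where g = "\<lambda>U. U - W"], blast)
    also have "\<dots> = (\<Sum>B\<in>Pow (V - W). (- 1) ^ card W * ((- 1) ^ card B * of_bool (exposed_subset W (W \<union> B))))"
    proof (rule sum.cong[OF refl])
      fix B assume "B \<in> Pow (V - W)"
      then have "finite B" "W \<inter> B = {}" using assms finite_subset by auto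
      then show "(- 1) ^ card (W \<union> B) * of_bool (exposed_subset W (W \<union> B))
        = ((- 1) ^ card W * ((- 1) ^ card B * of_bool (exposed_subset W (W \<union> B))) :: real)"
        using finW by (simp add: card_Un_disjoint power_add)
    qed
    also have "\<dots> = (- 1) ^ card W * alternating_sum (V - W) (\<lambda>B. of_bool (exposed_subset W (W \<union> B)))"
      by (simp add: alternating_sum_def sum_distrib_left)
    finally have "alternating_sum V (\<lambda>U. of_bool (exposed_subset W U))
      = (- 1) ^ card W * (if spanning_subset W V then (- 1) ^ (?d V + ?d W) else 0)"
      using alternating_sum_exposed[OF assms W] by simp
    moreover have "(- 1) ^ ?d W * (- 1) ^ ?d W = (1 :: real)"
      by (simp flip: power_add)
    ultimately show "(- 1) ^ ?d W * f W * alternating_sum V (\<lambda>U. of_bool (exposed_subset W U))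
      = (- 1) ^ ?d V * ((- 1) ^ card W * (of_bool (spanning_subset W V) * f W))"
      by (simp add: power_add)
  qed
  also have "\<dots> = (- 1) ^ ?d V *
      alternating_sum V (\<lambda>W. of_bool (spanning_subset W V \<and> W \<noteq> {}) * f W)"
    unfolding alternating_sum_def sum_distrib_left
    by (rule sum.mono_neutral_cong_left) (use assms in auto)
  finally show ?thesis .
qed

lemma exposed_subset_refl: "exposed_subset V V"
proof -
  have "\<forall>w\<in>V. 0 \<bullet> w = 0" by simp
  then show ?thesis
    unfolding exposed_subset_def by (metis Diff_cancel empty_iff order_refl)
qed

text \<open>
  A face of a face is a face: add a large multiple of the functional that exposes \<open>Y\<close>.
\<close>

lemma exposed_subset_refine:
  assumes "finite V" "exposed_subset Y V" and "\<forall>v\<in>Y. b \<bullet> v \<ge> d"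
  shows "exposed_subset {v \<in> Y. b \<bullet> v = d} V"
proof -
  obtain a c where ac: "Y \<subseteq> V" "\<forall>w\<in>Y. a \<bullet> w = c" "\<forall>v\<in>V - Y. a \<bullet> v > c"
    using assms(2) unfolding exposed_subset_def by blast
  obtain M where M: "M > 0" "\<forall>v\<in>V - Y. (b \<bullet> v - d) + M * (a \<bullet> v - c) > 0"
    using exists_large_multiple[of "V - Y" "\<lambda>v. a \<bullet> v - c" "\<lambda>v. b \<bullet> v - d"] assms(1) ac by auto
  have "(\<forall>w\<in>{v \<in> Y. b \<bullet> v = d}. (b + M *\<^sub>R a) \<bullet> w = d + M * c)
    \<and> (\<forall>v\<in>V - {v \<in> Y. b \<bullet> v = d}. (b + M *\<^sub>R a) \<bullet> v > d + M * c)"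
  proof (intro conjI ballI)
    fix v assume v: "v \<in> V - {v \<in> Y. b \<bullet> v = d}"
    show "(b + M *\<^sub>R a) \<bullet> v > d + M * c"
    proof (cases "v \<in> Y")
      case True
      then show ?thesis using v ac assms(3) by (auto simp: inner_add_left order_less_le)
    next
      case False
      then have "(b \<bullet> v - d) + M * (a \<bullet> v - c) > 0" using M v by blast
      then show ?thesis by (simp add: inner_add_left algebra_simps)
    qed
  qed (use ac in \<open>auto simp: inner_add_left\<close>)
  then show ?thesis
    using ac(1) unfolding exposed_subset_def by blast
qed

text \<open>
  \<open>Y\<close> is the trace of the smallest face that contains \<open>W\<close>. Existence follows by taking
  an exposed set of least cardinality that contains \<open>W\<close>, which cannot be refined any further.
\<close>

lemma ex1_exposed_subset_spanned:
  assumes "finite V" "W \<subseteq> V"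
  shows "\<exists>!Y. exposed_subset Y V \<and> spanning_subset W Y"
proof -
  let ?Q = "\<lambda>Y. exposed_subset Y V \<and> W \<subseteq> Y"
  have "?Q V" using assms exposed_subset_refl by blast
  then obtain Y where Y: "?Q Y" and min: "\<And>Y'. ?Q Y' \<Longrightarrow> card Y \<le> card Y'"
    using ex_has_least_nat[of ?Q V card] by blast
  have finY: "finite Y" using Y assms(1) finite_subset unfolding exposed_subset_def by blast
  have "spanning_subset W Y"
    unfolding spanning_subset_def
  proof (intro conjI allI impI)
    fix b d assume b: "\<forall>w\<in>W. b \<bullet> w = d" "\<forall>v\<in>Y. b \<bullet> v \<ge> d"
    have "?Q {v \<in> Y. b \<bullet> v = d}"
      using exposed_subset_refine[OF assms(1) _ b(2)] Y b by auto
    from min[OF this] have "{v \<in> Y. b \<bullet> v = d} = Y"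
      using finY by (intro card_seteq) auto
    then show "\<forall>v\<in>Y. b \<bullet> v = d" by blast
  qed (use Y in auto)
  moreover have sub: "Y1 \<subseteq> Y2"
    if Y12: "exposed_subset Y1 V" "spanning_subset W Y1" "exposed_subset Y2 V" "spanning_subset W Y2" for Y1 Y2
  proof -
    obtain a c where ac: "Y2 \<subseteq> V" "\<forall>w\<in>Y2. a \<bullet> w = c" "\<forall>v\<in>V - Y2. a \<bullet> v > c"
      using Y12(3) unfolding exposed_subset_def by blast
    have "\<forall>w\<in>W. a \<bullet> w = c" using Y12(4) ac unfolding spanning_subset_def by blast
    moreover have "\<forall>v\<in>Y1. a \<bullet> v \<ge> c"
      using Y12(1) ac unfolding exposed_subset_def by (metis DiffI less_imp_le order_refl subsetD)
    ultimately have "\<forall>v\<in>Y1. a \<bullet> v = c" using Y12(2) unfolding spanning_subset_def by blast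
    then show ?thesis using Y12(1) ac unfolding exposed_subset_def by (metis DiffI less_irrefl subset_iff)
  qed
  ultimately show ?thesis using Y by (metis subset_antisym)
qed

lemma alternating_sum_by_exposed_subset:
  assumes "finite V"
  shows "alternating_sum V (\<lambda>W. of_bool (W \<noteq> {}) * f W)
    = (\<Sum>Y | exposed_subset Y V \<and> Y \<noteq> {}.
        alternating_sum Y (\<lambda>W. of_bool (spanning_subset W Y \<and> W \<noteq> {}) * f W))"
proof -
  let ?E = "{Y. exposed_subset Y V \<and> Y \<noteq> {}}"
  have finE: "finite ?E"
    using assms by (intro finite_subset[of ?E "Pow V"]) (auto simp: exposed_subset_def)
  have "(\<Sum>Y\<in>?E. alternating_sum Y (\<lambda>W. of_bool (spanning_subset W Y \<and> W \<noteq> {}) * f W))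
    = (\<Sum>Y\<in>?E. alternating_sum V (\<lambda>W. of_bool (spanning_subset W Y \<and> W \<noteq> {}) * f W))"
  proof (rule sum.cong[OF refl])
    fix Y assume "Y \<in> ?E"
    then have "Y \<subseteq> V" by (simp add: exposed_subset_def)
    then show "alternating_sum Y (\<lambda>W. of_bool (spanning_subset W Y \<and> W \<noteq> {}) * f W)
      = alternating_sum V (\<lambda>W. of_bool (spanning_subset W Y \<and> W \<noteq> {}) * f W)"
      unfolding alternating_sum_def
      by (intro sum.mono_neutral_left) (use assms in \<open>auto simp: spanning_subset_def\<close>)
  qed
  also have "\<dots> = alternating_sum V (\<lambda>W. \<Sum>Y\<in>?E. of_bool (spanning_subset W Y \<and> W \<noteq> {}) * f W)"
    by (simp add: alternating_sum_sum)
  also have "\<dots> = alternating_sum V (\<lambda>W. of_bool (W \<noteq> {}) * f W)"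
  proof (rule alternating_sum_cong)
    fix W assume W: "W \<subseteq> V"
    show "(\<Sum>Y\<in>?E. of_bool (spanning_subset W Y \<and> W \<noteq> {}) * f W) = of_bool (W \<noteq> {}) * f W"
    proof (cases "W = {}")
      case False
      obtain Y where Y: "exposed_subset Y V" "spanning_subset W Y"
        and uniq: "\<And>Y'. exposed_subset Y' V \<Longrightarrow> spanning_subset W Y' \<Longrightarrow> Y' = Y"
        using ex1_exposed_subset_spanned[OF assms W] by blast
      have "Y \<in> ?E" using Y False by (auto simp: spanning_subset_def)
      then have "(\<Sum>Y\<in>?E. of_bool (spanning_subset W Y \<and> W \<noteq> {}) * f W)
        = (\<Sum>Y\<in>{Y}. of_bool (spanning_subset W Y \<and> W \<noteq> {}) * f W)"
        by (intro sum.mono_neutral_right finE) (use uniq in auto)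
      then show ?thesis using Y False by simp
    qed simp
  qed
  finally show ?thesis ..
qed

section \<open>Face sums\<close>

definition face_sum :: "('a::euclidean_space set \<Rightarrow> real) \<Rightarrow> 'a set \<Rightarrow> real"
  where "face_sum \<phi> P = (\<Sum>F | F face_of P \<and> F \<noteq> {}. (- 1) ^ nat (aff_dim F) * \<phi> F)"

lemma face_sum_convex_hull:
  assumes "finite V"
  shows "face_sum \<phi> (convex hull V)
    = (\<Sum>W | exposed_subset W V \<and> W \<noteq> {}. (- 1) ^ nat (aff_dim W) * \<phi> (convex hull W))"
  unfolding face_sum_def sum_faces_eq_sum_exposed_subsets[OF assms] aff_dim_convex_hull ..

lemma face_sum_empty [simp]: "face_sum \<phi> {} = 0"
proof -
  have "{F. F face_of ({}::'a set) \<and> F \<noteq> {}} = {}" by auto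
  then show ?thesis unfolding face_sum_def by (simp only: sum.empty)
qed

lemma exposed_subset_scaleR_iff:
  assumes "m > 0"
  shows "exposed_subset ((*\<^sub>R) m ` W) ((*\<^sub>R) m ` V) \<longleftrightarrow> exposed_subset W V"
proof -
  have inj: "inj ((*\<^sub>R) m :: 'a \<Rightarrow> 'a)"
    using assms by (simp add: inj_on_def)
  have eq: "(\<forall>w\<in>(*\<^sub>R) m ` W. a \<bullet> w = c) \<and> (\<forall>v\<in>(*\<^sub>R) m ` V - (*\<^sub>R) m ` W. a \<bullet> v > c)
    \<longleftrightarrow> (\<forall>w\<in>W. a \<bullet> w = c / m) \<and> (\<forall>v\<in>V - W. a \<bullet> v > c / m)" for a c
    unfolding image_set_diff[OF inj, symmetric]
    using assms by (auto simp: field_simps)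
  have "(\<exists>c. (\<forall>w\<in>W. a \<bullet> w = c / m) \<and> (\<forall>v\<in>V - W. a \<bullet> v > c / m))
    \<longleftrightarrow> (\<exists>c. (\<forall>w\<in>W. a \<bullet> w = c) \<and> (\<forall>v\<in>V - W. a \<bullet> v > c))" for a
  proof
    assume "\<exists>c. (\<forall>w\<in>W. a \<bullet> w = c) \<and> (\<forall>v\<in>V - W. a \<bullet> v > c)"
    then obtain c where "(\<forall>w\<in>W. a \<bullet> w = c) \<and> (\<forall>v\<in>V - W. a \<bullet> v > c)" by blast
    then show "\<exists>c. (\<forall>w\<in>W. a \<bullet> w = c / m) \<and> (\<forall>v\<in>V - W. a \<bullet> v > c / m)"
      using assms by (intro exI[of _ "c * m"]) simp
  qed blast
  then show ?thesis
    unfolding exposed_subset_def eq by (simp add: inj_image_subset_iff[OF inj])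
qed

lemma face_sum_scaleR:
  fixes V :: "'a::euclidean_space set"
  assumes "finite V" "m > 0"
    and "\<And>W. W \<subseteq> V \<Longrightarrow> \<phi> (convex hull ((*\<^sub>R) m ` W)) = C * \<phi> (convex hull W)"
  shows "face_sum \<phi> (convex hull ((*\<^sub>R) m ` V)) = C * face_sum \<phi> (convex hull V)"
proof -
  have inj: "inj ((*\<^sub>R) m :: 'a \<Rightarrow> 'a)"
    using assms(2) by (simp add: inj_on_def)
  have lin: "linear ((*\<^sub>R) m :: 'a \<Rightarrow> 'a)" by simp
  let ?E = "{W. exposed_subset W V \<and> W \<noteq> {}}"
  have E: "{W. exposed_subset W ((*\<^sub>R) m ` V) \<and> W \<noteq> {}} = (`) ((*\<^sub>R) m) ` ?E" (is "?L = ?R")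
  proof (intro subset_antisym subsetI)
    fix W assume W: "W \<in> ?L"
    then obtain W' where "W = (*\<^sub>R) m ` W'"
      unfolding exposed_subset_def by (auto elim!: subset_imageE)
    then have "W' \<in> ?E" using W by (simp add: exposed_subset_scaleR_iff[OF assms(2)])
    then show "W \<in> ?R" using \<open>W = (*\<^sub>R) m ` W'\<close> by (rule image_eqI[rotated])
  next
    fix W assume "W \<in> ?R"
    then obtain W' where "W' \<in> ?E" "W = (*\<^sub>R) m ` W'" by (rule imageE)
    then show "W \<in> ?L" by (simp add: exposed_subset_scaleR_iff[OF assms(2)])
  qed
  have "inj_on ((`) ((*\<^sub>R) m)) ?E"
    by (intro inj_onI) (simp only: inj_image_eq_iff[OF inj])
  then have "face_sum \<phi> (convex hull ((*\<^sub>R) m ` V))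
    = (\<Sum>W\<in>?E. (- 1) ^ nat (aff_dim ((*\<^sub>R) m ` W)) * \<phi> (convex hull ((*\<^sub>R) m ` W)))"
    unfolding face_sum_convex_hull[OF finite_imageI[OF assms(1)]] E
    by (subst sum.reindex) simp_all
  also have "\<dots> = (\<Sum>W\<in>?E. C * ((- 1) ^ nat (aff_dim W) * \<phi> (convex hull W)))"
  proof (rule sum.cong[OF refl])
    fix W assume "W \<in> ?E"
    then have "W \<subseteq> V" by (simp add: exposed_subset_def)
    then show "(- 1) ^ nat (aff_dim ((*\<^sub>R) m ` W)) * \<phi> (convex hull ((*\<^sub>R) m ` W))
      = C * ((- 1) ^ nat (aff_dim W) * \<phi> (convex hull W))"
      using assms(3) by (simp add: aff_dim_injective_linear_image[OF lin inj])
  qed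
  also have "\<dots> = C * face_sum \<phi> (convex hull V)"
    by (simp add: face_sum_convex_hull[OF assms(1)] sum_distrib_left)
  finally show ?thesis .
qed

lemma exposed_subset_affine_independent:
  fixes V :: "'a::euclidean_space set"
  assumes "\<not> affine_dependent V" "W \<subseteq> V"
  shows "exposed_subset W V"
proof -
  have "finite V" using assms(1) by (rule aff_independent_finite)
  moreover have "convex hull W face_of convex hull V"
    using assms face_of_convex_hull_affine_independent by blast
  moreover have "V \<inter> convex hull W = W"
  proof -
    have False if w: "w \<in> V" "w \<in> convex hull W" "w \<notin> W" for w
    proof -
      have "W \<subseteq> V - {w}" using assms(2) w by blast
      then have "w \<in> affine hull (V - {w})"
        using w(2) convex_hull_subset_affine_hull[of W] hull_mono[of W "V - {w}" affine] by blast
      then show False using assms(1) w(1) unfolding affine_dependent_def by blast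
    qed
    moreover have "W \<subseteq> convex hull W" by (rule hull_subset)
    ultimately show ?thesis using assms(2) by blast
  qed
  ultimately show ?thesis using face_exposed_subset[of V "convex hull W"] by simp
qed

lemma exposed_subset_convex_hull_closed:
  assumes "exposed_subset Y V" "W \<subseteq> Y" "q \<in> convex hull W" "q \<in> V"
  shows "q \<in> Y"
proof -
  obtain a c where ac: "\<forall>w\<in>Y. a \<bullet> w = c" "\<forall>v\<in>V - Y. a \<bullet> v > c"
    using assms(1) unfolding exposed_subset_def by blast
  have "convex hull W \<subseteq> {x. a \<bullet> x = c}"
    using ac assms(2) by (intro hull_minimal convex_hyperplane) auto
  then have "a \<bullet> q = c" using assms(3) by blast
  then show ?thesis using ac(2) assms(4) by (metis DiffI less_irrefl)
qed

section \<open>Lattice Radon points\<close>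

text \<open>
  Scale a real dependence by an integer that makes all its coefficients nearly integral (Dirichlet)
  and round. The rounded coefficients yield sums that are small integers, hence \<open>0\<close>; they
  are not all zero since that of \<open>v0\<close> is close to the scaling factor.
\<close>

lemma integral_affine_dependence:
  fixes V :: "(real ^ 'n) set"
  assumes "finite V" "V \<subseteq> int_lattice" "affine_dependent V"
  obtains c :: "real ^ 'n \<Rightarrow> int" where "\<exists>v\<in>V. c v \<noteq> 0" "sum c V = 0" "(\<Sum>v\<in>V. real_of_int (c v) *\<^sub>R v) = 0"
proof -
  obtain u v0 where u: "sum u V = 0" "v0 \<in> V" "u v0 \<noteq> 0" "(\<Sum>v\<in>V. u v *\<^sub>R v) = 0"
    using assms(3) unfolding affine_dependent_explicit_finite[OF assms(1)] by blast
  define w where "w v = u v / u v0" for v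
  have w: "sum w V = 0" "w v0 = 1" "(\<Sum>v\<in>V. w v *\<^sub>R v) = 0"
  proof -
    show "sum w V = 0" using u by (simp add: w_def flip: sum_divide_distrib)
    show "w v0 = 1" using u by (simp add: w_def)
    have "(\<Sum>v\<in>V. w v *\<^sub>R v) = (1 / u v0) *\<^sub>R (\<Sum>v\<in>V. u v *\<^sub>R v)"
      by (simp add: w_def scaleR_sum_right)
    then show "(\<Sum>v\<in>V. w v *\<^sub>R v) = 0" using u by simp
  qed
  obtain e and n :: nat where e: "bij_betw e {..<n} V"
    using ex_bij_betw_nat_finite[OF assms(1)] unfolding atLeast0LessThan by blast
  \<comment> \<open>Rounding errors below \<open>1 / N\<close> keep the absolute values of the sum of the
    coefficients and of every coordinate of the dependence below \<open>1\<close>.\<close>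
  define N where "N = nat \<lceil>real (card V) + (\<Sum>v\<in>V. \<Sum>k\<in>UNIV. \<bar>v $ k\<bar>)\<rceil> + 1"
  have S0: "(\<Sum>v\<in>V. \<Sum>k\<in>UNIV. \<bar>v $ k\<bar>) \<ge> 0" by (intro sum_nonneg) auto
  have N: "real N > real (card V)" "real N > (\<Sum>v\<in>V. \<Sum>k\<in>UNIV. \<bar>v $ k\<bar>)" "N > 0"
    using S0 unfolding N_def by linarith+
  obtain q p where qp: "0 < q" "\<And>l. l < n \<Longrightarrow> \<bar>of_int q * w (e l) - of_int (p l)\<bar> < 1 / N"
    using Dirichlet_approx_simult[OF N(3), of n "\<lambda>l. w (e l)"] by metis
  define c where "c v = p (inv_into {..<n} e v)" for v
  have c: "\<bar>of_int q * w v - of_int (c v)\<bar> < 1 / N" if "v \<in> V" for v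
    using qp(2)[of "inv_into {..<n} e v"] that e
    by (metis bij_betw_imp_surj_on bij_betw_inv_into_right c_def inv_into_into lessThan_iff)
  have small: "(\<Sum>v\<in>V. of_int (c v) * g v) = 0"
    if g: "\<And>v. v \<in> V \<Longrightarrow> g v \<in> \<int>" "(\<Sum>v\<in>V. w v * g v) = 0" "(\<Sum>v\<in>V. \<bar>g v\<bar>) < N" for g
  proof -
    have "(\<Sum>v\<in>V. of_int (c v) * g v) = - (\<Sum>v\<in>V. (of_int q * w v - of_int (c v)) * g v)"
      using g(2) by (simp add: left_diff_distrib sum_subtractf mult.assoc flip: sum_distrib_left)
    then have "\<bar>\<Sum>v\<in>V. of_int (c v) * g v\<bar> \<le> (\<Sum>v\<in>V. \<bar>(of_int q * w v - of_int (c v)) * g v\<bar>)"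
      by (simp add: sum_abs)
    also have "\<dots> \<le> (\<Sum>v\<in>V. 1 / N * \<bar>g v\<bar>)"
      unfolding abs_mult using c by (intro sum_mono mult_right_mono) (auto intro: less_imp_le)
    also have "\<dots> < 1"
      using g(3) N(3) by (simp add: divide_simps flip: sum_divide_distrib)
    finally have "\<bar>\<Sum>v\<in>V. of_int (c v) * g v\<bar> < 1" .
    moreover have "(\<Sum>v\<in>V. of_int (c v) * g v) \<in> \<int>"
      using g(1) by (intro Ints_sum Ints_mult) auto
    ultimately show ?thesis
      by (metis Ints_nonzero_abs_less1)
  qed
  have "real_of_int (sum c V) = 0"
    using small[of "\<lambda>_. 1"] w N by simp
  then have "sum c V = 0" by (simp only: of_int_eq_0_iff)
  moreover have "(\<Sum>v\<in>V. real_of_int (c v) *\<^sub>R v) = 0"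
  proof (rule vec_eq_iff[THEN iffD2], rule allI)
    fix k
    have "(\<Sum>v\<in>V. of_int (c v) * v $ k) = 0"
    proof (rule small)
      show "v $ k \<in> \<int>" if "v \<in> V" for v
        using that assms(2) by (auto simp: int_lattice_def)
      have "(\<Sum>v\<in>V. w v *\<^sub>R v) $ k = 0" using w by simp
      then show "(\<Sum>v\<in>V. w v * v $ k) = 0" by simp
      have "(\<Sum>v\<in>V. \<bar>v $ k\<bar>) \<le> (\<Sum>v\<in>V. \<Sum>k\<in>UNIV. \<bar>v $ k\<bar>)"
        by (intro sum_mono member_le_sum) auto
      then show "(\<Sum>v\<in>V. \<bar>v $ k\<bar>) < N" using N by linarith
    qed
    then show "(\<Sum>v\<in>V. real_of_int (c v) *\<^sub>R v) $ k = 0 $ k" by simp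
  qed
  moreover have "c v0 \<noteq> 0"
  proof
    assume "c v0 = 0"
    then have "of_int q < 1 / real N" using c[OF u(2)] w qp by simp
    moreover have "1 / real N \<le> 1" using N by simp
    ultimately show False using qp by linarith
  qed
  ultimately show ?thesis using that u(2) by blast
qed

text \<open>
  Splitting an integral affine dependence into its positive and its negative part writes one point in
  two ways as a combination of disjoint subsets of \<open>V\<close>. Each \<open>u\<close> is missing from one of the two.
  The factor \<open>m\<close>, the sum of the positive coefficients, makes that point a lattice point.
\<close>

lemma integral_Radon_point:
  fixes V :: "(real ^ 'n) set"
  assumes "finite V" "V \<subseteq> int_lattice" "affine_dependent V"
  obtains m :: nat and q where "m > 0" "q \<in> int_lattice"
    "\<And>u. u \<in> V \<Longrightarrow> q \<in> convex hull ((*\<^sub>R) (real m) ` (V - {u}))"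
proof -
  obtain c :: "real ^ 'n \<Rightarrow> int" where
    c: "\<exists>v\<in>V. c v \<noteq> 0" "sum c V = 0" "(\<Sum>v\<in>V. real_of_int (c v) *\<^sub>R v) = 0"
    using integral_affine_dependence[OF assms] by blast
  define P where "P = {v\<in>V. c v > 0}"
  define Q where "Q = {v\<in>V. c v < 0}"
  have fin: "finite P" "finite Q" using assms(1) by (auto simp: P_def Q_def)
  have split: "sum g V = sum g P + sum g Q" if "\<And>v. c v = 0 \<Longrightarrow> g v = 0" for g :: "_ \<Rightarrow> 'b::comm_monoid_add"
  proof -
    have "sum g V = sum g (P \<union> Q)"
      using assms(1) that by (intro sum.mono_neutral_right)
        (auto simp: P_def Q_def, metis linorder_neqE_linordered_idom)
    then show ?thesis using fin by (simp add: sum.union_disjoint P_def Q_def disjoint_iff)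
  qed
  define m where "m = nat (sum c P)"
  define q where "q = (\<Sum>v\<in>P. real_of_int (c v) *\<^sub>R v)"
  have sumQ: "sum c Q = - sum c P" using c(2) split[of c] by simp
  have qQ: "q = (\<Sum>v\<in>Q. (- real_of_int (c v)) *\<^sub>R v)"
    using c(3) split[of "\<lambda>v. real_of_int (c v) *\<^sub>R v"]
    by (simp add: q_def sum_negf eq_neg_iff_add_eq_0)
  have "P \<noteq> {}"
  proof
    assume P: "P = {}"
    then have "sum c Q = 0" using sumQ by simp
    then have "\<forall>v\<in>Q. - c v = 0"
      using fin(2) sum_nonneg_eq_0_iff[of Q "\<lambda>v. - c v"] by (auto simp: Q_def sum_negf)
    then have "Q = {}" by (auto simp: Q_def)
    with P c(1) show False by (auto simp: P_def Q_def) (metis linorder_neqE_linordered_idom)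
  qed
  then have "sum c P > 0" using fin by (intro sum_pos) (auto simp: P_def)
  then have m: "m > 0" "real m = real_of_int (sum c P)" by (auto simp: m_def)
  have hull: "(\<Sum>v\<in>S. d v *\<^sub>R v) \<in> convex hull ((*\<^sub>R) (real m) ` T)"
    if "S \<subseteq> T" "finite S" "\<And>v. v \<in> S \<Longrightarrow> d v \<ge> 0" "sum d S = real m" for S T d
  proof -
    have "(\<Sum>v\<in>S. (d v / real m) *\<^sub>R (real m *\<^sub>R v)) \<in> convex hull ((*\<^sub>R) (real m) ` T)"
      using that m by (intro convex_sum) (auto simp: hull_inc simp flip: sum_divide_distrib)
    then show ?thesis using m(1) by simp
  qed
  show ?thesis
  proof (rule that[OF m(1)])
    show "q \<in> int_lattice"
      unfolding q_def int_lattice_def using assms(2)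
      by (auto simp: P_def int_lattice_def intro!: Ints_sum Ints_mult)
    fix u assume "u \<in> V"
    show "q \<in> convex hull ((*\<^sub>R) (real m) ` (V - {u}))"
    proof (cases "c u > 0")
      case True
      have "(\<Sum>v\<in>Q. - real_of_int (c v)) = real_of_int (- sum c Q)"
        by (simp add: sum_negf)
      then have "(\<Sum>v\<in>Q. - real_of_int (c v)) = real m"
        unfolding sumQ using m by simp
      with True show ?thesis
        unfolding qQ using fin by (intro hull) (auto simp: Q_def)
    next
      case False
      then show ?thesis
        unfolding q_def using fin m by (intro hull) (auto simp: P_def)
    qed
  qed
qed

section \<open>Face sums of reciprocal pairs\<close>

text \<open>
  Both functions are alternating sums of the other one over the hulls of subsets of a generating
  set, whichever generating set of lattice points is chosen.
\<close>

locale reciprocal_pair =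
  fixes \<phi> \<psi> :: "(real ^ 'n) set \<Rightarrow> real" and i :: nat
  assumes inversion: "finite V \<Longrightarrow> V \<noteq> {} \<Longrightarrow> V \<subseteq> int_lattice \<Longrightarrow>
      \<psi> (convex hull V) = - alternating_sum V (\<lambda>U. of_bool (U \<noteq> {}) * \<phi> (convex hull U))"
    and inversion': "finite V \<Longrightarrow> V \<noteq> {} \<Longrightarrow> V \<subseteq> int_lattice \<Longrightarrow>
      \<phi> (convex hull V) = - alternating_sum V (\<lambda>U. of_bool (U \<noteq> {}) * \<psi> (convex hull U))"
    and scale: "finite V \<Longrightarrow> V \<subseteq> int_lattice \<Longrightarrow>
      \<phi> (convex hull ((*\<^sub>R) (real k) ` V)) = real k ^ i * \<phi> (convex hull V)"
    and scale': "finite V \<Longrightarrow> V \<subseteq> int_lattice \<Longrightarrow>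
      \<psi> (convex hull ((*\<^sub>R) (real k) ` V)) = real k ^ i * \<psi> (convex hull V)"
begin

text \<open>
  The hypothesis turns the inversion formula for \<open>\<phi> (conv Y)\<close> into an alternating sum of face sums,
  and hence into a sum over the spanning subsets of \<open>Y\<close>. Summing over the faces \<open>conv Y\<close> of the polytope
  collects every nonempty subset of \<open>V\<close> exactly once, which is the inversion formula for \<open>\<psi>\<close>.
\<close>

lemma face_sum_eq_if_alternating_sums_eq:
  assumes V: "finite V" "V \<noteq> {}" "V \<subseteq> int_lattice"
    and eq: "\<And>Y. exposed_subset Y V \<Longrightarrow> Y \<noteq> {} \<Longrightarrow>
      alternating_sum Y (\<lambda>U. face_sum \<phi> (convex hull U))
        = alternating_sum Y (\<lambda>U. of_bool (U \<noteq> {}) * \<psi> (convex hull U))"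
  shows "face_sum \<phi> (convex hull V) = \<psi> (convex hull V)"
proof -
  let ?g = "\<lambda>Y. alternating_sum Y (\<lambda>W. of_bool (spanning_subset W Y \<and> W \<noteq> {}) * \<phi> (convex hull W))"
  have "face_sum \<phi> (convex hull V) = (\<Sum>Y | exposed_subset Y V \<and> Y \<noteq> {}. - ?g Y)"
    unfolding face_sum_convex_hull[OF V(1)]
  proof (rule sum.cong[OF refl])
    fix Y assume "Y \<in> {Y. exposed_subset Y V \<and> Y \<noteq> {}}"
    then have Y: "exposed_subset Y V" "Y \<noteq> {}" "Y \<subseteq> V" by (auto simp: exposed_subset_def)
    have finY: "finite Y" using Y V finite_subset by blast
    have "\<phi> (convex hull Y) = - alternating_sum Y (\<lambda>U. face_sum \<phi> (convex hull U))"
      using inversion'[of Y] eq[of Y] finY Y V(3) by simp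
    also have "alternating_sum Y (\<lambda>U. face_sum \<phi> (convex hull U))
      = alternating_sum Y (\<lambda>U. \<Sum>W | exposed_subset W U \<and> W \<noteq> {}.
          (- 1) ^ nat (aff_dim W) * \<phi> (convex hull W))"
      by (rule alternating_sum_cong, rule face_sum_convex_hull) (rule finite_subset[OF _ finY])
    also have "\<dots> = (- 1) ^ nat (aff_dim Y) * ?g Y"
      by (rule alternating_sum_face_sums[OF finY])
    finally have "\<phi> (convex hull Y) = - ((- 1) ^ nat (aff_dim Y) * ?g Y)" .
    then show "(- 1) ^ nat (aff_dim Y) * \<phi> (convex hull Y) = - ?g Y"
      by (simp flip: mult.assoc power_add)
  qed
  also have "\<dots> = - alternating_sum V (\<lambda>W. of_bool (W \<noteq> {}) * \<phi> (convex hull W))"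
    unfolding alternating_sum_by_exposed_subset[OF V(1)] by (rule sum_negf)
  also have "\<dots> = \<psi> (convex hull V)" using inversion V by simp
  finally show ?thesis .
qed

text \<open>
  Induction on the number of generators. After a dilation a Radon point \<open>q\<close> is available as an
  additional generator of the hull of \<open>V1\<close>, and each nonempty subset of \<open>insert q V1\<close> that does not contain \<open>V1\<close>
  has a hull that is generated by fewer than \<open>|V|\<close> points.
\<close>

theorem face_sum_eq:
  assumes "finite V" "V \<noteq> {}" "V \<subseteq> int_lattice"
  shows "face_sum \<phi> (convex hull V) = \<psi> (convex hull V)"
  using assms
proof (induction "card V" arbitrary: V rule: less_induct)
  case less
  note V = less.prems
  show ?case
  proof (cases "affine_dependent V")
    case False
    have "{W. exposed_subset W V \<and> W \<noteq> {}} = Pow V - {{}}"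
      using exposed_subset_affine_independent[OF False] by (auto simp: exposed_subset_def)
    then have "face_sum \<phi> (convex hull V)
      = (\<Sum>W\<in>Pow V - {{}}. (- 1) ^ nat (aff_dim W) * \<phi> (convex hull W))"
      using face_sum_convex_hull[OF V(1)] by simp
    also have "\<dots> = (\<Sum>W\<in>Pow V - {{}}. - ((- 1) ^ card W * (of_bool (W \<noteq> {}) * \<phi> (convex hull W))))"
    proof (rule sum.cong[OF refl])
      fix W assume W: "W \<in> Pow V - {{}}"
      then have "finite W" "\<not> affine_dependent W"
        using False affine_dependent_subset[of W V] finite_subset[OF _ V(1)] by blast+
      moreover from this have "card W > 0"
        using W by (auto simp: card_gt_0_iff)
      ultimately have "card W = Suc (nat (aff_dim W))"
        using aff_dim_affine_independent[of W] by linarith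
      then show "(- 1) ^ nat (aff_dim W) * \<phi> (convex hull W)
        = - ((- 1) ^ card W * (of_bool (W \<noteq> {}) * \<phi> (convex hull W)))"
        using W by simp
    qed
    also have "\<dots> = - alternating_sum V (\<lambda>W. of_bool (W \<noteq> {}) * \<phi> (convex hull W))"
      unfolding alternating_sum_def sum_negf
      using V(1) by (intro arg_cong[of _ _ uminus] sum.mono_neutral_left) auto
    also have "\<dots> = \<psi> (convex hull V)" using inversion V by simp
    finally show ?thesis .
  next
    case True
    obtain m :: nat and q where m: "m > 0" and q: "q \<in> int_lattice"
      "\<And>u. u \<in> V \<Longrightarrow> q \<in> convex hull ((*\<^sub>R) (real m) ` (V - {u}))"
      using integral_Radon_point[OF V(1,3) True] by blast
    define V1 where "V1 = (*\<^sub>R) (real m) ` V"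
    define V2 where "V2 = insert q V1"
    have inj: "inj_on ((*\<^sub>R) (real m)) V" using m by (simp add: inj_on_def)
    have V1: "finite V1" "V1 \<noteq> {}" "V1 \<subseteq> int_lattice" "card V1 = card V"
      using V inj by (auto simp: V1_def card_image int_lattice_def)
    have q1: "q \<in> convex hull (V1 - {u})" if u: "u \<in> V1" for u
    proof -
      obtain u' where u': "u' \<in> V" "u = real m *\<^sub>R u'" using u by (auto simp: V1_def)
      then have "V1 - {u} = (*\<^sub>R) (real m) ` (V - {u'})" using m by (auto simp: V1_def)
      then show ?thesis using q(2)[OF u'(1)] by simp
    qed
    have qV1: "q \<in> convex hull V1"
    proof -
      obtain u where "u \<in> V1" using V1 by blast
      then have "q \<in> convex hull (V1 - {u})" by (rule q1)
      then show ?thesis using hull_mono[of "V1 - {u}" V1 convex] by blast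
    qed
    have hull_insert_q: "convex hull (insert q S) = convex hull S" if "q \<in> convex hull S" for S
      by (rule hull_redundant) (use that in simp)
    have small: "face_sum \<phi> (convex hull U) = \<psi> (convex hull U)"
      if U: "U \<subseteq> V2" "U \<noteq> {}" "\<not> V1 \<subseteq> U" for U
    proof -
      obtain u where u: "u \<in> V1" "u \<notin> U" using U by blast
      show ?thesis
      proof (cases "U \<subseteq> V1 - {u}")
        case True
        then have "card U < card V"
          using V1 u by (metis card_Diff1_less card_mono finite_Diff order_le_less_trans)
        moreover have "finite U" "U \<subseteq> int_lattice"
          using True V1 finite_subset by blast+
        ultimately show ?thesis using less.hyps U by blast
      next
        case False
        then have qU: "q \<in> U" using U u by (auto simp: V2_def)
        define U0 where "U0 = U - {q}"
        have U0: "U = insert q U0" "q \<notin> U0" "U0 \<subseteq> V1 - {u}"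
          using qU U u by (auto simp: U0_def V2_def)
        have finU0: "finite U0" using U0 V1 finite_subset by blast
        have card_le: "card U0 \<le> card V - 1"
          using U0(3) V1 u by (metis card_Diff_singleton card_mono finite_Diff)
        have cV: "card V > 0" using V by (simp add: card_gt_0_iff)
        show ?thesis
        proof (cases "U0 = V1 - {u}")
          case True
          \<comment> \<open>here \<open>q\<close> is redundant in \<open>U\<close>, as it is a Radon point\<close>
          then have hull: "convex hull U = convex hull U0"
            using hull_insert_q[of U0] q1[OF u(1)] U0 by simp
          have "U0 \<noteq> {}"
            using q1[OF u(1)] unfolding True by fastforce
          moreover have "card U0 < card V" using card_le cV by linarith
          moreover have "U0 \<subseteq> int_lattice" using U0 V1 by blast
          ultimately show ?thesis unfolding hull using less.hyps finU0 by blast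
        next
          case False
          then have "card U0 < card (V1 - {u})"
            using U0 V1 by (intro psubset_card_mono) auto
          then have "card U < card V"
            using U0 finU0 V1 u by simp
          moreover have "finite U" "U \<subseteq> int_lattice"
            using U0 finU0 V1 q by auto
          ultimately show ?thesis using less.hyps U by blast
        qed
      qed
    qed
    have V2: "finite V2" "V2 \<noteq> {}" "V2 \<subseteq> int_lattice" using V1 q by (auto simp: V2_def)
    have hull2: "convex hull V2 = convex hull V1"
      unfolding V2_def by (rule hull_insert_q[OF qV1])
    have "face_sum \<phi> (convex hull V1) = \<psi> (convex hull V1)"
    proof (cases "q \<in> V1")
      case True
      have "convex hull V1 = convex hull (V1 - {q})"
        using hull_insert_q[OF q1[OF True]] True by (simp add: insert_absorb)
      moreover have "V1 - {q} \<noteq> {}"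
        using q1[OF True] by fastforce
      moreover have "\<not> V1 \<subseteq> V1 - {q}" "V1 - {q} \<subseteq> V2"
        using True by (auto simp: V2_def)
      ultimately show ?thesis
        using small[of "V1 - {q}"] by simp
    next
      case False
      have "face_sum \<phi> (convex hull V2) = \<psi> (convex hull V2)"
      proof (rule face_sum_eq_if_alternating_sums_eq[OF V2])
        fix Y assume Y: "exposed_subset Y V2" "Y \<noteq> {}"
        let ?D = "\<lambda>U. face_sum \<phi> (convex hull U) - of_bool (U \<noteq> {}) * \<psi> (convex hull U)"
        have YV2: "Y \<subseteq> V2" using Y by (simp add: exposed_subset_def)
        have D0: "?D U = 0" if "U \<subseteq> V2" "\<not> V1 \<subseteq> U" for U
          using small[of U] that by (cases "U = {}") auto
        \<comment> \<open>Only \<open>V1\<close> and \<open>insert q V1\<close> are out of reach of the induction hypothesis; they have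
          the same hull and opposite signs.\<close>
        have "alternating_sum Y ?D = 0"
        proof (cases "V1 \<subseteq> Y")
          case True
          have "q \<in> Y"
            by (rule exposed_subset_convex_hull_closed[OF Y(1) True qV1]) (simp add: V2_def)
          with True YV2 have YV: "Y = V2" by (auto simp: V2_def)
          show ?thesis
            unfolding YV
          proof (rule alternating_sum_cancel[OF V2(1), of q])
            fix B assume "B \<subseteq> V2 - {q}"
            then have B: "B \<subseteq> V1" by (auto simp: V2_def)
            show "?D (insert q B) = ?D B"
            proof (cases "B = V1")
              case True
              then show ?thesis using hull_insert_q[OF qV1] V1 by simp
            next
              case False
              then have "\<not> V1 \<subseteq> insert q B" "\<not> V1 \<subseteq> B"
                using B \<open>q \<notin> V1\<close> by auto
              moreover have "B \<subseteq> V2" "insert q B \<subseteq> V2" using B by (auto simp: V2_def)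
              ultimately show ?thesis using D0[of B] D0[of "insert q B"] by linarith
            qed
          qed (simp add: V2_def)
        next
          case False
          have "alternating_sum Y ?D = alternating_sum Y (\<lambda>_. 0)"
            by (rule alternating_sum_cong, rule D0) (use False YV2 in auto)
          then show ?thesis by simp
        qed
        then show "alternating_sum Y (\<lambda>U. face_sum \<phi> (convex hull U))
          = alternating_sum Y (\<lambda>U. of_bool (U \<noteq> {}) * \<psi> (convex hull U))"
          by (simp add: alternating_sum_diff)
      qed
      then show ?thesis by (simp add: hull2)
    qed
    moreover have "face_sum \<phi> (convex hull V1) = real m ^ i * face_sum \<phi> (convex hull V)"
      unfolding V1_def
    proof (rule face_sum_scaleR)
      show "\<phi> (convex hull (*\<^sub>R) (real m) ` W) = real m ^ i * \<phi> (convex hull W)" if "W \<subseteq> V" for W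
        by (rule scale) (use that V finite_subset in blast)+
    qed (use V m in auto)
    moreover have "\<psi> (convex hull V1) = real m ^ i * \<psi> (convex hull V)"
      unfolding V1_def by (rule scale') (use V in auto)
    ultimately show ?thesis using m by simp
  qed
qed

end

section \<open>Projected slices of dilated simplices\<close>

definition lattice_valuation :: "((real ^ 'n) set \<Rightarrow> real) \<Rightarrow> bool"
  where "lattice_valuation \<phi> \<longleftrightarrow> \<phi> {} = 0 \<and>
    (\<forall>P Q. P \<in> lattice_polytopes \<and> Q \<in> lattice_polytopes \<and>
       P \<union> Q \<in> lattice_polytopes \<and> P \<inter> Q \<in> lattice_polytopes \<longrightarrow>
       \<phi> P + \<phi> Q = \<phi> (P \<union> Q) + \<phi> (P \<inter> Q))"

lemma convex_hull_in_lattice_polytopes: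
  assumes "finite G" "G \<subseteq> int_lattice"
  shows "convex hull G \<in> lattice_polytopes"
  unfolding lattice_polytopes_def polytope_def
  using assms extreme_point_of_convex_hull by blast

lemma lattice_polytope_generators:
  assumes "P \<in> lattice_polytopes"
  obtains V where "finite V" "V \<subseteq> int_lattice" "P = convex hull V"
proof (rule that)
  have P: "polytope P" "{x. x extreme_point_of P} \<subseteq> int_lattice"
    using assms by (auto simp: lattice_polytopes_def)
  show "finite {x. x extreme_point_of P}"
    using P(1) by (simp add: finite_polyhedron_extreme_points polytope_imp_polyhedron)
  show "{x. x extreme_point_of P} \<subseteq> int_lattice" by (rule P(2))
  show "P = convex hull {x. x extreme_point_of P}"
    using P(1) by (simp add: Krein_Milman_Minkowski polytope_imp_compact polytope_imp_convex)
qed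

lemma int_lattice_0 [simp]: "0 \<in> int_lattice"
  by (simp add: int_lattice_def)

lemma int_lattice_add: "x \<in> int_lattice \<Longrightarrow> y \<in> int_lattice \<Longrightarrow> x + y \<in> int_lattice"
  by (simp add: int_lattice_def)

lemma int_lattice_minus: "x \<in> int_lattice \<Longrightarrow> - x \<in> int_lattice"
  by (simp add: int_lattice_def)

lemma int_lattice_scaleR: "a \<in> \<int> \<Longrightarrow> x \<in> int_lattice \<Longrightarrow> a *\<^sub>R x \<in> int_lattice"
  by (simp add: int_lattice_def)

lemma int_lattice_sum: "(\<And>l. l \<in> I \<Longrightarrow> f l \<in> int_lattice) \<Longrightarrow> sum f I \<in> int_lattice"
  by (induction I rule: infinite_finite_induct) (auto intro: int_lattice_add)

text \<open>
  The image of a part of the hyperplane \<open>\<Sum>t = k\<close>, cut out by one condition on each coordinate, under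
  the linear map that sends the basis vectors to the points \<open>v l\<close>.
\<close>

definition slice :: "'b set \<Rightarrow> ('b \<Rightarrow> 'a::real_vector) \<Rightarrow> int \<Rightarrow> ('b \<Rightarrow> real set) \<Rightarrow> 'a set"
  where "slice I v k s = {\<Sum>l\<in>I. t l *\<^sub>R v l | t. sum t I = real_of_int k \<and> (\<forall>l\<in>I. t l \<in> s l)}"

lemma sliceI:
  assumes "z = (\<Sum>l\<in>I. t l *\<^sub>R v l)" "sum t I = real_of_int k" "\<And>l. l \<in> I \<Longrightarrow> t l \<in> s l"
  shows "z \<in> slice I v k s"
  unfolding slice_def using assms by blast

lemma sliceE:
  assumes "z \<in> slice I v k s"
  obtains t where "z = (\<Sum>l\<in>I. t l *\<^sub>R v l)" "sum t I = real_of_int k" "\<And>l. l \<in> I \<Longrightarrow> t l \<in> s l"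
proof -
  from assms obtain t where "z = (\<Sum>l\<in>I. t l *\<^sub>R v l) \<and> sum t I = real_of_int k \<and> (\<forall>l\<in>I. t l \<in> s l)"
    unfolding slice_def by blast
  then show thesis by (intro that[of t]) auto
qed

text \<open>
  The states of the exchange. The lower bounds make slices bounded, and since the endpoints are integers,
  the slices are lattice polytopes if the points \<open>v l\<close> are lattice points.
\<close>

definition unit_bounds :: "real set set"
  where "unit_bounds = {{-1..}, {0..}, {-1..0}, {0}}"

lemma slice_convex:
  assumes "\<And>l. l \<in> I \<Longrightarrow> convex (s l)"
  shows "convex (slice I v k s)"
proof (rule convexI)
  fix z z' and u w :: real assume z: "z \<in> slice I v k s" "z' \<in> slice I v k s"
    and uw: "0 \<le> u" "0 \<le> w" "u + w = 1"
  obtain t where t: "z = (\<Sum>l\<in>I. t l *\<^sub>R v l)" "sum t I = k" "\<And>l. l \<in> I \<Longrightarrow> t l \<in> s l"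
    by (rule sliceE[OF z(1)]) (rule that)
  obtain t' where t': "z' = (\<Sum>l\<in>I. t' l *\<^sub>R v l)" "sum t' I = k" "\<And>l. l \<in> I \<Longrightarrow> t' l \<in> s l"
    by (rule sliceE[OF z(2)]) (rule that)
  let ?t = "\<lambda>l. u * t l + w * t' l"
  have "sum ?t I = u * real_of_int k + w * real_of_int k"
    by (simp add: sum.distrib t(2) t'(2) flip: sum_distrib_left)
  also have "\<dots> = k" by (metis distrib_right mult_1 uw(3))
  finally have "sum ?t I = k" .
  moreover have "u *\<^sub>R z + w *\<^sub>R z' = (\<Sum>l\<in>I. ?t l *\<^sub>R v l)"
    by (simp add: t(1) t'(1) scaleR_sum_right scaleR_add_left sum.distrib)
  moreover have "?t l \<in> s l" if "l \<in> I" for l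
    using convexD[OF assms[OF that] t(3)[OF that] t'(3)[OF that] uw] by simp
  ultimately show "u *\<^sub>R z + w *\<^sub>R z' \<in> slice I v k s"
    by (intro sliceI[where t = ?t])
qed

lemma unit_bounds_convex: "b \<in> unit_bounds \<Longrightarrow> convex b"
  by (auto simp: unit_bounds_def)

lemma unit_bounds_integral:
  assumes "b \<in> unit_bounds" "x \<in> b" "real_of_int \<lfloor>x\<rfloor> \<le> y" "y \<le> real_of_int \<lceil>x\<rceil>"
  shows "y \<in> b"
proof -
  have "- 1 \<le> y" if "- 1 \<le> x"
  proof -
    have "- 1 \<le> \<lfloor>x\<rfloor>" using that by (simp add: le_floor_iff)
    then show ?thesis using assms(3) by linarith
  qed
  moreover have "0 \<le> y" if "0 \<le> x"
  proof -
    have "0 \<le> \<lfloor>x\<rfloor>" using that by simp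
    then show ?thesis using assms(3) by linarith
  qed
  moreover have "y \<le> 0" if "x \<le> 0"
  proof -
    have "\<lceil>x\<rceil> \<le> 0" using that by simp
    then show ?thesis using assms(4) by linarith
  qed
  ultimately show ?thesis
    using assms(1,2) unfolding unit_bounds_def by auto
qed

lemma sum_fun_upd2:
  fixes g :: "'b \<Rightarrow> real \<Rightarrow> 'a::ab_group_add"
  assumes "finite I" "l \<in> I" "l' \<in> I" "l \<noteq> l'"
  shows "(\<Sum>x\<in>I. g x ((t(l := a, l' := b)) x)) = (\<Sum>x\<in>I. g x (t x)) + (g l a - g l (t l)) + (g l' b - g l' (t l'))"
proof -
  have I: "I = insert l (insert l' (I - {l, l'}))" using assms by blast
  have "(\<Sum>x\<in>I - {l, l'}. g x ((t(l := a, l' := b)) x)) = (\<Sum>x\<in>I - {l, l'}. g x (t x))"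
    by (rule sum.cong) auto
  then show ?thesis
    using assms by (subst (1 2) I) (simp add: algebra_simps)
qed

text \<open>
  Shifting weight from \<open>l'\<close> to \<open>l\<close> until one of the two coordinates becomes an integer keeps
  the sum, and keeps the bounds because they are integers.
\<close>

lemma move_towards_integral:
  fixes t :: "'b \<Rightarrow> real"
  assumes I: "finite I" "l \<in> I" "l' \<in> I" "l \<noteq> l'" and nonint: "t l \<notin> \<int>" "t l' \<notin> \<int>"
    and s: "\<And>x. s x \<in> unit_bounds" "\<And>x. x \<in> I \<Longrightarrow> t x \<in> s x"
  obtains d where "d > 0" "\<And>x. x \<in> I \<Longrightarrow> (t(l := t l + d, l' := t l' - d)) x \<in> s x"
    "card {x \<in> I. (t(l := t l + d, l' := t l' - d)) x \<notin> \<int>} < card {x \<in> I. t x \<notin> \<int>}"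
proof -
  define d where "d = min (real_of_int \<lceil>t l\<rceil> - t l) (t l' - real_of_int \<lfloor>t l'\<rfloor>)"
  let ?t = "t(l := t l + d, l' := t l' - d)"
  have neq: "real_of_int \<lceil>t l\<rceil> \<noteq> t l" "real_of_int \<lfloor>t l'\<rfloor> \<noteq> t l'"
    using nonint by (metis Ints_of_int)+
  have d: "d > 0"
  proof -
    have "real_of_int \<lceil>t l\<rceil> - t l > 0" using neq(1) le_of_int_ceiling[of "t l"] by linarith
    moreover have "t l' - real_of_int \<lfloor>t l'\<rfloor> > 0" using neq(2) of_int_floor_le[of "t l'"] by linarith
    ultimately show ?thesis by (simp add: d_def)
  qed
  moreover have "?t x \<in> s x" if "x \<in> I" for x
  proof -
    have "t l + d \<in> s l"
      by (rule unit_bounds_integral[OF s(1) s(2)[OF I(2)]]) (use d in \<open>auto simp: d_def; linarith\<close>)+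
    moreover have "t l' - d \<in> s l'"
      by (rule unit_bounds_integral[OF s(1) s(2)[OF I(3)]]) (use d in \<open>auto simp: d_def; linarith\<close>)+
    ultimately show ?thesis using s(2)[OF that] by simp
  qed
  moreover have "card {x \<in> I. ?t x \<notin> \<int>} < card {x \<in> I. t x \<notin> \<int>}"
  proof (rule psubset_card_mono)
    have "t l + d \<in> \<int> \<or> t l' - d \<in> \<int>"
      by (cases "real_of_int \<lceil>t l\<rceil> - t l \<le> t l' - real_of_int \<lfloor>t l'\<rfloor>") (auto simp: d_def min_def)
    then show "{x \<in> I. ?t x \<notin> \<int>} \<subset> {x \<in> I. t x \<notin> \<int>}"
      using I nonint by (auto split: if_splits)
  qed (use I in simp)
  ultimately show ?thesis using that by blast
qed

text \<open>
  The sum of the coordinates is an integer, so a point with a nonintegral coordinate has two of them.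
  It lies between the two points reached by shifting weight between these coordinates in
  either direction, both of which have fewer nonintegral coordinates.
\<close>

lemma slice_point_in_hull_integral_points:
  fixes v :: "'b \<Rightarrow> 'a::real_vector"
  assumes "finite I" and s: "\<And>x. s x \<in> unit_bounds"
    and "sum t I = real_of_int k" "\<And>x. x \<in> I \<Longrightarrow> t x \<in> s x"
  shows "(\<Sum>l\<in>I. t l *\<^sub>R v l) \<in> convex hull {\<Sum>l\<in>I. t l *\<^sub>R v l | t.
    sum t I = real_of_int k \<and> (\<forall>l\<in>I. t l \<in> s l \<and> t l \<in> \<int>)}" (is "_ \<in> convex hull ?G")
  using assms(3,4)
proof (induction "card {x \<in> I. t x \<notin> \<int>}" arbitrary: t rule: less_induct)
  case less
  show ?case
  proof (cases "\<forall>x\<in>I. t x \<in> \<int>")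
    case True
    then have "(\<Sum>l\<in>I. t l *\<^sub>R v l) \<in> ?G" using less.prems by blast
    then show ?thesis by (rule hull_inc)
  next
    case False
    then obtain l where l: "l \<in> I" "t l \<notin> \<int>" by blast
    have "\<exists>l'\<in>I - {l}. t l' \<notin> \<int>"
    proof (rule ccontr)
      assume "\<not> ?thesis"
      then have "sum t (I - {l}) \<in> \<int>" by (intro Ints_sum) auto
      moreover have "t l = real_of_int k - sum t (I - {l})"
        using less.prems(1) sum.remove[OF assms(1) l(1), of t] by simp
      ultimately show False using l by auto
    qed
    then obtain l' where l': "l' \<in> I" "l \<noteq> l'" "t l' \<notin> \<int>" by blast
    have moved: "\<exists>d>0. (\<Sum>x\<in>I. t x *\<^sub>R v x) + d *\<^sub>R (v m - v m') \<in> convex hull ?G"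
      if m: "m \<in> I" "m' \<in> I" "m \<noteq> m'" "t m \<notin> \<int>" "t m' \<notin> \<int>" for m m'
    proof -
      obtain d where d: "d > 0" "\<And>x. x \<in> I \<Longrightarrow> (t(m := t m + d, m' := t m' - d)) x \<in> s x"
        "card {x \<in> I. (t(m := t m + d, m' := t m' - d)) x \<notin> \<int>} < card {x \<in> I. t x \<notin> \<int>}"
        by (rule move_towards_integral[OF assms(1) m s less.prems(2)]) (assumption, rule that)
      let ?t = "t(m := t m + d, m' := t m' - d)"
      have "sum ?t I = real_of_int k"
        using sum_fun_upd2[OF assms(1) m(1-3), of "\<lambda>_ x. x" t] less.prems(1) by simp
      from less.hyps[OF d(3) this d(2)]
      have "(\<Sum>x\<in>I. ?t x *\<^sub>R v x) \<in> convex hull ?G" .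
      moreover have "(\<Sum>x\<in>I. ?t x *\<^sub>R v x) = (\<Sum>x\<in>I. t x *\<^sub>R v x) + d *\<^sub>R (v m - v m')"
        unfolding sum_fun_upd2[OF assms(1) m(1-3), of "\<lambda>x r. r *\<^sub>R v x" t "t m + d" "t m' - d"]
        by (simp add: algebra_simps)
      ultimately have "(\<Sum>x\<in>I. t x *\<^sub>R v x) + d *\<^sub>R (v m - v m') \<in> convex hull ?G" by simp
      then show ?thesis using d(1) by blast
    qed
    obtain d1 where d1: "d1 > 0" "(\<Sum>x\<in>I. t x *\<^sub>R v x) + d1 *\<^sub>R (v l - v l') \<in> convex hull ?G"
      using moved[of l l'] l l' by blast
    obtain d2 where d2: "d2 > 0" "(\<Sum>x\<in>I. t x *\<^sub>R v x) + d2 *\<^sub>R (v l' - v l) \<in> convex hull ?G"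
      using moved[of l' l] l l' by blast
    define a b where "a = d2 / (d1 + d2)" and "b = d1 / (d1 + d2)"
    have ab: "a \<ge> 0" "b \<ge> 0" "a + b = 1" "a * d1 = b * d2"
      using d1(1) d2(1) by (simp_all add: a_def b_def flip: add_divide_distrib)
    let ?z = "\<Sum>x\<in>I. t x *\<^sub>R v x"
    have "a *\<^sub>R (?z + d1 *\<^sub>R (v l - v l')) + b *\<^sub>R (?z + d2 *\<^sub>R (v l' - v l)) \<in> convex hull ?G"
      using d1 d2 ab by (intro convexD[OF convex_convex_hull])
    also have "a *\<^sub>R (?z + d1 *\<^sub>R (v l - v l')) + b *\<^sub>R (?z + d2 *\<^sub>R (v l' - v l))
      = (a + b) *\<^sub>R ?z + (a * d1 - b * d2) *\<^sub>R (v l - v l')"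
      by (simp add: algebra_simps)
    also have "\<dots> = ?z" using ab by simp
    finally show ?thesis .
  qed
qed

lemma slice_in_lattice_polytopes:
  fixes v :: "'b \<Rightarrow> real ^ 'n"
  assumes I: "finite I" "v ` I \<subseteq> int_lattice" and s: "\<And>x. s x \<in> unit_bounds"
  shows "slice I v k s \<in> lattice_polytopes"
proof -
  let ?T = "{t. sum t I = real_of_int k \<and> (\<forall>l\<in>I. t l \<in> s l \<and> t l \<in> \<int>)}"
  define G where "G = (\<lambda>t. \<Sum>l\<in>I. t l *\<^sub>R v l) ` ?T"
  have G_eq: "G = {\<Sum>l\<in>I. t l *\<^sub>R v l | t. sum t I = real_of_int k \<and> (\<forall>l\<in>I. t l \<in> s l \<and> t l \<in> \<int>)}"
    unfolding G_def by auto
  have "slice I v k s \<subseteq> convex hull G"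
  proof
    fix z assume z: "z \<in> slice I v k s"
    obtain t where t: "z = (\<Sum>l\<in>I. t l *\<^sub>R v l)" "sum t I = real_of_int k" "\<And>l. l \<in> I \<Longrightarrow> t l \<in> s l"
      by (rule sliceE[OF z]) (rule that)
    show "z \<in> convex hull G"
      unfolding t(1) G_eq by (rule slice_point_in_hull_integral_points[OF I(1) s t(2,3)])
  qed
  moreover have "convex hull G \<subseteq> slice I v k s"
    using s by (intro hull_minimal slice_convex unit_bounds_convex) (auto simp: G_def slice_def)
  ultimately have "slice I v k s = convex hull G" by blast
  moreover have "finite G"
  proof -
    define N where "N = \<bar>k\<bar> + int (card I)"
    have "G \<subseteq> (\<lambda>t. \<Sum>l\<in>I. t l *\<^sub>R v l) ` (PiE I (\<lambda>_. real_of_int ` {-1..N}))"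
    proof
      fix z assume "z \<in> G"
      then obtain t where t: "z = (\<Sum>l\<in>I. t l *\<^sub>R v l)" "t \<in> ?T" by (auto simp: G_def)
      have ge: "t l \<ge> - 1" if "l \<in> I" for l
        using t(2) that s[of l] by (auto simp: unit_bounds_def)
      have le: "t l \<le> N" if "l \<in> I" for l
      proof -
        have "sum (\<lambda>_. - 1) (I - {l}) \<le> sum t (I - {l})"
          using ge by (intro sum_mono) auto
        then have "- real (card I) \<le> sum t (I - {l})"
          using I(1) that by (simp add: card_Diff_singleton)
        moreover have "t l = real_of_int k - sum t (I - {l})"
          using t(2) sum.remove[OF I(1) that, of t] by simp
        ultimately show ?thesis unfolding N_def by linarith
      qed
      have "t l \<in> real_of_int ` {-1..N}" if l: "l \<in> I" for l
      proof -
        have "t l \<in> \<int>" using t(2) l by blast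
        then obtain j where j: "t l = real_of_int j" by (rule Ints_cases)
        then have "j \<in> {-1..N}" using ge[OF l] le[OF l] by auto
        then show ?thesis using j by blast
      qed
      then have "restrict t I \<in> PiE I (\<lambda>_. real_of_int ` {-1..N})" by auto
      moreover have "z = (\<Sum>l\<in>I. restrict t I l *\<^sub>R v l)" unfolding t(1) by simp
      ultimately show "z \<in> (\<lambda>t. \<Sum>l\<in>I. t l *\<^sub>R v l) ` (PiE I (\<lambda>_. real_of_int ` {-1..N}))" by blast
    qed
    moreover have "finite (PiE I (\<lambda>_. real_of_int ` {-1..N}))"
      using I(1) by (intro finite_PiE) auto
    ultimately show ?thesis using finite_subset by blast
  qed
  moreover have "G \<subseteq> int_lattice"
    unfolding G_def using I(2) by (auto intro!: int_lattice_sum int_lattice_scaleR)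
  ultimately show ?thesis using convex_hull_in_lattice_polytopes by metis
qed

text \<open>
  The projection of an intersection can be smaller than the intersection of the projections. Here they agree:
  points of the two pieces with the same image are joined by a segment whose points all have that image, and
  this segment crosses the cutting hyperplane.
\<close>

lemma slice_cut:
  fixes v :: "'b \<Rightarrow> real ^ 'n"
  assumes I: "finite I" "l \<in> I" and s: "range s \<subseteq> unit_bounds"
  shows "slice I v k (s(l := {-1..})) = slice I v k (s(l := {0..})) \<union> slice I v k (s(l := {-1..0}))"
    "slice I v k (s(l := {0})) = slice I v k (s(l := {0..})) \<inter> slice I v k (s(l := {-1..0}))"
proof -
  have mono: "slice I v k s1 \<subseteq> slice I v k s2" if s12: "\<And>x. s1 x \<subseteq> s2 x" for s1 s2
  proof
    fix z assume "z \<in> slice I v k s1"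
    then show "z \<in> slice I v k s2"
      by (rule sliceE) (rule sliceI, use s12 in auto)
  qed
  show "slice I v k (s(l := {-1..})) = slice I v k (s(l := {0..})) \<union> slice I v k (s(l := {-1..0}))"
  proof
    show "slice I v k (s(l := {-1..})) \<subseteq> slice I v k (s(l := {0..})) \<union> slice I v k (s(l := {-1..0}))"
    proof
      fix z assume z: "z \<in> slice I v k (s(l := {-1..}))"
      obtain t where t: "z = (\<Sum>l\<in>I. t l *\<^sub>R v l)" "sum t I = real_of_int k"
        "\<And>x. x \<in> I \<Longrightarrow> t x \<in> (s(l := {-1..})) x"
        by (rule sliceE[OF z]) (rule that)
      have "(\<forall>x\<in>I. t x \<in> (s(l := {0..})) x) \<or> (\<forall>x\<in>I. t x \<in> (s(l := {-1..0})) x)"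
      proof -
        have "t x \<in> s x" if "x \<in> I" "x \<noteq> l" for x using t(3)[OF that(1)] that(2) by simp
        then show ?thesis using t(3)[OF I(2)] by (cases "t l \<ge> 0") auto
      qed
      then show "z \<in> slice I v k (s(l := {0..})) \<union> slice I v k (s(l := {-1..0}))"
        using sliceI[OF t(1,2)] by blast
    qed
    show "slice I v k (s(l := {0..})) \<union> slice I v k (s(l := {-1..0})) \<subseteq> slice I v k (s(l := {-1..}))"
      by (intro Un_least mono) auto
  qed
  show "slice I v k (s(l := {0})) = slice I v k (s(l := {0..})) \<inter> slice I v k (s(l := {-1..0}))"
  proof
    show "slice I v k (s(l := {0})) \<subseteq> slice I v k (s(l := {0..})) \<inter> slice I v k (s(l := {-1..0}))"
      by (intro Int_greatest mono) auto
    show "slice I v k (s(l := {0..})) \<inter> slice I v k (s(l := {-1..0})) \<subseteq> slice I v k (s(l := {0}))"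
    proof
      fix z assume z: "z \<in> slice I v k (s(l := {0..})) \<inter> slice I v k (s(l := {-1..0}))"
      obtain t where t: "z = (\<Sum>l\<in>I. t l *\<^sub>R v l)" "sum t I = real_of_int k"
        "\<And>x. x \<in> I \<Longrightarrow> t x \<in> (s(l := {0..})) x"
        by (rule sliceE[OF IntD1[OF z]]) (rule that)
      obtain t' where t': "z = (\<Sum>l\<in>I. t' l *\<^sub>R v l)" "sum t' I = real_of_int k"
        "\<And>x. x \<in> I \<Longrightarrow> t' x \<in> (s(l := {-1..0})) x"
        by (rule sliceE[OF IntD2[OF z]]) (rule that)
      have tl: "t l \<ge> 0" "t' l \<le> 0" using t(3)[OF I(2)] t'(3)[OF I(2)] by auto
      obtain u w where uw: "u \<ge> 0" "w \<ge> 0" "u + w = 1" "u * t l + w * t' l = 0"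
      proof (cases "t l - t' l = 0")
        case True
        then show ?thesis using that[of 1 0] tl by simp
      next
        case False
        then have pos: "t l - t' l > 0" using tl by simp
        show ?thesis
        proof (rule that[of "- t' l / (t l - t' l)" "t l / (t l - t' l)"])
          show "- t' l / (t l - t' l) + t l / (t l - t' l) = 1"
            using pos by (simp add: divide_simps)
        qed (use pos tl in \<open>auto simp: divide_simps\<close>)
      qed
      let ?t = "\<lambda>x. u * t x + w * t' x"
      have "sum ?t I = u * real_of_int k + w * real_of_int k"
        by (simp add: sum.distrib t(2) t'(2) flip: sum_distrib_left)
      also have "\<dots> = k" by (metis distrib_right mult_1 uw(3))
      finally have "sum ?t I = k" .
      moreover have "z = (\<Sum>l\<in>I. ?t l *\<^sub>R v l)"
      proof -
        have "z = u *\<^sub>R z + w *\<^sub>R z" using uw(3) by (metis scaleR_add_left scaleR_one)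
        also have "u *\<^sub>R z = (\<Sum>l\<in>I. (u * t l) *\<^sub>R v l)" unfolding t(1) by (simp add: scaleR_sum_right)
        also have "w *\<^sub>R z = (\<Sum>l\<in>I. (w * t' l) *\<^sub>R v l)" unfolding t'(1) by (simp add: scaleR_sum_right)
        finally show ?thesis by (simp add: scaleR_add_left sum.distrib)
      qed
      moreover have "?t x \<in> (s(l := {0})) x" if "x \<in> I" for x
      proof (cases "x = l")
        case False
        have "convex (s x)" using s unit_bounds_convex by blast
        moreover have "t x \<in> s x" "t' x \<in> s x" using t(3)[OF that] t'(3)[OF that] False by auto
        ultimately have "?t x \<in> s x" using convexD[of "s x" "t x" "t' x" u w] uw by simp
        then show ?thesis using False by simp
      qed (use uw in simp)
      ultimately show "z \<in> slice I v k (s(l := {0}))" by (intro sliceI[where t = ?t])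
    qed
  qed
qed

lemma slice_exchange:
  fixes v :: "'b \<Rightarrow> real ^ 'n"
  assumes \<phi>: "lattice_valuation \<phi>" and I: "finite I" "v ` I \<subseteq> int_lattice"
  shows "alternating_sum I (\<lambda>J. \<phi> (slice I v k (\<lambda>l. if l \<in> J then {-1..} else {0..})))
    = alternating_sum I (\<lambda>J. \<phi> (slice I v k (\<lambda>l. if l \<in> J then {-1..0} else {0})))"
proof -
  define F where "F s = \<phi> (slice I v k s)" for s
  have F_cong: "F s = F s'" if "\<And>l. l \<in> I \<Longrightarrow> s l = s' l" for s s'
    unfolding F_def slice_def using that by (metis (no_types, lifting))
  have cut: "F (s(l := {0..})) - F (s(l := {-1..})) = F (s(l := {0})) - F (s(l := {-1..0}))"
    if s: "range s \<subseteq> unit_bounds" and l: "l \<in> I" for s l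
  proof -
    have mem: "slice I v k (s(l := b)) \<in> lattice_polytopes" if "b \<in> unit_bounds" for b
      using s that by (intro slice_in_lattice_polytopes[OF I]) auto
    note cut = slice_cut[OF I(1) l s, of v k]
    have "\<phi> (slice I v k (s(l := {0..}))) + \<phi> (slice I v k (s(l := {-1..0})))
      = \<phi> (slice I v k (s(l := {-1..}))) + \<phi> (slice I v k (s(l := {0})))"
      using \<phi> mem[of "{0..}"] mem[of "{-1..0}"] mem[of "{-1..}"] mem[of "{0}"]
      unfolding lattice_valuation_def cut by (simp add: unit_bounds_def)
    then show ?thesis unfolding F_def by simp
  qed
  have "alternating_sum I (\<lambda>J. F (\<lambda>l. if l \<in> J then {-1..} else if l \<in> I then {0..} else {0}))
    = alternating_sum I (\<lambda>J. F (\<lambda>l. if l \<in> J then {-1..0} else if l \<in> I then {0} else {0}))"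
    by (rule alternating_sum_exchange[where S = unit_bounds, OF I(1) cut]) (auto simp: unit_bounds_def)
  moreover have "alternating_sum I (\<lambda>J. F (\<lambda>l. if l \<in> J then {-1..} else if l \<in> I then {0..} else {0}))
    = alternating_sum I (\<lambda>J. F (\<lambda>l. if l \<in> J then {-1..} else {0..}))"
    by (rule alternating_sum_cong, rule F_cong) simp
  moreover have "alternating_sum I (\<lambda>J. F (\<lambda>l. if l \<in> J then {-1..0} else if l \<in> I then {0} else {0}))
    = alternating_sum I (\<lambda>J. F (\<lambda>l. if l \<in> J then {-1..0} else {0}))"
    by (rule alternating_sum_cong, rule F_cong) simp
  ultimately show ?thesis unfolding F_def by simp
qed

section \<open>Alternating sums of Minkowski translates\<close>

lemma convex_hull_image_eq_slice:
  assumes "finite I"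
  shows "convex hull (v ` I) = slice I v 1 (\<lambda>_. {0..})"
proof
  show "convex hull (v ` I) \<subseteq> slice I v 1 (\<lambda>_. {0..})"
  proof (rule hull_minimal)
    show "v ` I \<subseteq> slice I v 1 (\<lambda>_. {0..})"
    proof
      fix z assume "z \<in> v ` I"
      then obtain l where l: "l \<in> I" "z = v l" by blast
      show "z \<in> slice I v 1 (\<lambda>_. {0..})"
      proof (rule sliceI[where t = "\<lambda>x. of_bool (x = l)"])
        have "(\<Sum>x\<in>I. of_bool (x = l) *\<^sub>R v x) = (\<Sum>x\<in>I. if x = l then v x else 0)"
          by (rule sum.cong) auto
        then show "z = (\<Sum>x\<in>I. of_bool (x = l) *\<^sub>R v x)"
          using assms l by (simp add: sum.delta)
      qed (use assms l in \<open>auto simp: of_bool_def sum.delta\<close>)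
    qed
  qed (rule slice_convex, simp)
  show "slice I v 1 (\<lambda>_. {0..}) \<subseteq> convex hull (v ` I)"
  proof
    fix z assume z: "z \<in> slice I v 1 (\<lambda>_. {0..})"
    obtain t where t: "z = (\<Sum>l\<in>I. t l *\<^sub>R v l)" "sum t I = real_of_int 1" "\<And>l. l \<in> I \<Longrightarrow> t l \<in> {0..}"
      by (rule sliceE[OF z]) (rule that)
    show "z \<in> convex hull (v ` I)"
      unfolding t(1) by (rule convex_sum) (use assms t in \<open>auto simp: hull_inc\<close>)
  qed
qed

text \<open>
  Adding \<open>1\<close> to the coordinates in \<open>J\<close> yields nonnegative coordinates with sum \<open>c\<close>, and adds \<open>sum v J\<close>
  to the image.
\<close>

lemma slice_shifted:
  assumes I: "finite I" "I \<noteq> {}" and J: "J \<subseteq> I" and c: "k + int (card J) = int c"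
  shows "slice I v k (\<lambda>l. if l \<in> J then {-1..} else {0..})
    = (\<lambda>x. x - sum v J) ` ((\<lambda>x. real c *\<^sub>R x) ` (convex hull (v ` I)))"
proof -
  have sum_J: "(\<Sum>l\<in>I. of_bool (l \<in> J) *\<^sub>R v l) = sum v J"
  proof -
    have "(\<Sum>l\<in>I. of_bool (l \<in> J) *\<^sub>R v l) = (\<Sum>l\<in>J. of_bool (l \<in> J) *\<^sub>R v l)"
      using I(1) J by (intro sum.mono_neutral_right) auto
    then show ?thesis by simp
  qed
  have card_J: "(\<Sum>l\<in>I. of_bool (l \<in> J)) = real (card J)"
  proof -
    have "(\<Sum>l\<in>I. of_bool (l \<in> J) :: real) = (\<Sum>l\<in>J. of_bool (l \<in> J))"
      using I(1) J by (intro sum.mono_neutral_right) auto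
    then show ?thesis by simp
  qed
  have c': "real_of_int k + real (card J) = real c"
    using c by (metis of_int_add of_int_of_nat_eq)
  show ?thesis
  proof (intro subset_antisym subsetI)
    fix z assume z: "z \<in> slice I v k (\<lambda>l. if l \<in> J then {-1..} else {0..})"
    obtain t where t: "z = (\<Sum>l\<in>I. t l *\<^sub>R v l)" "sum t I = real_of_int k"
      "\<And>l. l \<in> I \<Longrightarrow> t l \<in> (if l \<in> J then {-1..} else {0..})"
      by (rule sliceE[OF z]) (rule that)
    define u where "u l = t l + of_bool (l \<in> J)" for l
    have u: "u l \<ge> 0" if "l \<in> I" for l
      using t(3)[OF that] by (auto simp: u_def split: if_splits)
    have sum_u: "sum u I = real c"
      unfolding u_def by (simp only: sum.distrib t(2) card_J c')
    have z_eq: "z = (\<Sum>l\<in>I. u l *\<^sub>R v l) - sum v J"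
      unfolding u_def t(1) by (simp add: scaleR_add_left sum.distrib sum_J)
    have "\<exists>x\<in>convex hull (v ` I). real c *\<^sub>R x = (\<Sum>l\<in>I. u l *\<^sub>R v l)"
    proof (cases "c = 0")
      case True
      then have "\<forall>l\<in>I. u l = 0"
        using sum_u u I(1) by (simp add: sum_nonneg_eq_0_iff)
      moreover obtain l where "l \<in> I" using I(2) by blast
      ultimately show ?thesis
        using True by (intro bexI[of _ "v l"]) (auto simp: hull_inc)
    next
      case False
      have "(\<Sum>l\<in>I. (u l / real c) *\<^sub>R v l) \<in> slice I v 1 (\<lambda>_. {0..})"
        using u sum_u False by (intro sliceI[OF refl]) (auto simp flip: sum_divide_distrib)
      moreover have "real c *\<^sub>R (\<Sum>l\<in>I. (u l / real c) *\<^sub>R v l) = (\<Sum>l\<in>I. u l *\<^sub>R v l)"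
        using False by (simp add: scaleR_sum_right)
      ultimately show ?thesis
        unfolding convex_hull_image_eq_slice[OF I(1)] by blast
    qed
    then show "z \<in> (\<lambda>x. x - sum v J) ` ((\<lambda>x. real c *\<^sub>R x) ` (convex hull (v ` I)))"
      unfolding z_eq by force
  next
    fix z assume "z \<in> (\<lambda>x. x - sum v J) ` ((\<lambda>x. real c *\<^sub>R x) ` (convex hull (v ` I)))"
    then obtain x where x: "x \<in> slice I v 1 (\<lambda>_. {0..})" "z = real c *\<^sub>R x - sum v J"
      unfolding convex_hull_image_eq_slice[OF I(1)] by blast
    obtain t where t: "x = (\<Sum>l\<in>I. t l *\<^sub>R v l)" "sum t I = real_of_int 1" "\<And>l. l \<in> I \<Longrightarrow> t l \<in> {0..}"
      by (rule sliceE[OF x(1)]) (rule that)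
    show "z \<in> slice I v k (\<lambda>l. if l \<in> J then {-1..} else {0..})"
    proof (rule sliceI[where t = "\<lambda>l. real c * t l - of_bool (l \<in> J)"])
      show "z = (\<Sum>l\<in>I. (real c * t l - of_bool (l \<in> J)) *\<^sub>R v l)"
        unfolding x(2) t(1) by (simp add: scaleR_diff_left sum_subtractf sum_J scaleR_sum_right)
      show "(\<Sum>l\<in>I. real c * t l - of_bool (l \<in> J)) = real_of_int k"
        using t(2) c' by (simp add: sum_subtractf card_J flip: sum_distrib_left)
      show "real c * t l - of_bool (l \<in> J) \<in> (if l \<in> J then {-1..} else {0..})" if "l \<in> I" for l
        using t(3)[OF that] by simp
    qed
  qed
qed

text \<open>
  After the exchange the coordinates are nonpositive and have sum \<open>k\<close>, so that the slices
  are empty for \<open>k > 0\<close>, and equal to \<open>{0}\<close> for all \<open>J\<close> if \<open>k = 0\<close>.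
\<close>

lemma alternating_sum_Minkowski:
  fixes v :: "'b \<Rightarrow> real ^ 'n"
  assumes \<phi>: "lattice_valuation \<phi>" and I: "finite I" "I \<noteq> {}" "v ` I \<subseteq> int_lattice"
  shows "alternating_sum I (\<lambda>J. \<phi> ((\<lambda>x. x - sum v J) `
    ((\<lambda>x. real (k + card J) *\<^sub>R x) ` (convex hull (v ` I))))) = 0"
proof -
  let ?S = "\<lambda>J. slice I v (int k) (\<lambda>l. if l \<in> J then {-1..0} else {0})"
  have "alternating_sum I (\<lambda>J. \<phi> ((\<lambda>x. x - sum v J) `
      ((\<lambda>x. real (k + card J) *\<^sub>R x) ` (convex hull (v ` I)))))
    = alternating_sum I (\<lambda>J. \<phi> (slice I v (int k) (\<lambda>l. if l \<in> J then {-1..} else {0..})))"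
  proof (rule alternating_sum_cong)
    fix J assume J: "J \<subseteq> I"
    have "int k + int (card J) = int (k + card J)" by simp
    from slice_shifted[OF I(1,2) J this, of v]
    show "\<phi> ((\<lambda>x. x - sum v J) ` ((\<lambda>x. real (k + card J) *\<^sub>R x) ` (convex hull (v ` I))))
      = \<phi> (slice I v (int k) (\<lambda>l. if l \<in> J then {-1..} else {0..}))" by (simp only:)
  qed
  also have "\<dots> = alternating_sum I (\<lambda>J. \<phi> (?S J))"
    by (rule slice_exchange[OF \<phi> I(1,3)])
  also have "\<dots> = alternating_sum I (\<lambda>J. if k = 0 then \<phi> {0} else 0)"
  proof (rule alternating_sum_cong)
    fix J assume "J \<subseteq> I"
    have nonpos: "x \<le> 0" if "x \<in> (if b then {-1..0} else {0})" for x :: real and b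
      using that by (auto split: if_splits)
    show "\<phi> (?S J) = (if k = 0 then \<phi> {0} else 0)"
    proof (cases "k = 0")
      case True
      have "?S J = {0}"
      proof (intro subset_antisym subsetI)
        fix z assume z: "z \<in> ?S J"
        obtain t where t: "z = (\<Sum>l\<in>I. t l *\<^sub>R v l)" "sum t I = real_of_int (int k)"
          "\<And>l. l \<in> I \<Longrightarrow> t l \<in> (if l \<in> J then {-1..0} else {0})"
          by (rule sliceE[OF z]) (rule that)
        have "(\<Sum>l\<in>I. - t l) = 0" using t(2) True by (simp add: sum_negf)
        then have "\<forall>l\<in>I. - t l = 0"
          using nonpos[OF t(3)] I(1) by (subst (asm) sum_nonneg_eq_0_iff) auto
        then show "z \<in> {0}" unfolding t(1) by simp
      next
        fix z :: "real ^ 'n" assume "z \<in> {0}"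
        then show "z \<in> ?S J"
          using True by (intro sliceI[where t = "\<lambda>_. 0"]) auto
      qed
      then show ?thesis using True by simp
    next
      case False
      have "?S J = {}"
      proof (rule ccontr)
        assume "?S J \<noteq> {}"
        then obtain z where z: "z \<in> ?S J" by blast
        obtain t where t: "sum t I = real_of_int (int k)"
          "\<And>l. l \<in> I \<Longrightarrow> t l \<in> (if l \<in> J then {-1..0} else {0})"
          by (rule sliceE[OF z]) (rule that)
        have "sum t I \<le> 0" by (rule sum_nonpos) (rule nonpos[OF t(2)])
        then show False using t(1) False by simp
      qed
      then show ?thesis using False \<phi> by (simp add: lattice_valuation_def)
    qed
  qed
  also have "\<dots> = 0"
  proof -
    obtain l where "l \<in> I" using I by blast
    then show ?thesis by (intro alternating_sum_cancel[OF I(1)]) auto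
  qed
  finally show ?thesis .
qed

text \<open>
  The same exchange for coordinates with sum \<open>-1\<close>: the slices become reflected hulls. For
  \<open>J = {}\<close> the slices on both sides are empty.
\<close>

lemma alternating_sum_Minkowski_inverse:
  fixes v :: "'b \<Rightarrow> real ^ 'n"
  assumes \<phi>: "lattice_valuation \<phi>" and I: "finite I" "I \<noteq> {}" "v ` I \<subseteq> int_lattice"
  shows "alternating_sum I (\<lambda>J. of_bool (J \<noteq> {}) * \<phi> ((\<lambda>x. x - sum v J) `
      ((\<lambda>x. real (card J - 1) *\<^sub>R x) ` (convex hull (v ` I)))))
    = alternating_sum I (\<lambda>J. of_bool (J \<noteq> {}) * \<phi> (uminus ` (convex hull (v ` J))))"
proof -
  let ?S = "\<lambda>J. slice I v (- 1) (\<lambda>l. if l \<in> J then {-1..0} else {0})"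
  let ?S' = "\<lambda>J. slice I v (- 1) (\<lambda>l. if l \<in> J then {-1..} else {0..})"
  have "alternating_sum I (\<lambda>J. of_bool (J \<noteq> {}) * \<phi> ((\<lambda>x. x - sum v J) `
      ((\<lambda>x. real (card J - 1) *\<^sub>R x) ` (convex hull (v ` I)))))
    = alternating_sum I (\<lambda>J. \<phi> (?S' J))"
  proof (rule alternating_sum_cong)
    fix J assume J: "J \<subseteq> I"
    show "of_bool (J \<noteq> {}) * \<phi> ((\<lambda>x. x - sum v J) `
        ((\<lambda>x. real (card J - 1) *\<^sub>R x) ` (convex hull (v ` I)))) = \<phi> (?S' J)"
    proof (cases "J = {}")
      case True
      have "?S' J = {}"
      proof (rule ccontr)
        assume "?S' J \<noteq> {}"
        then obtain z where z: "z \<in> ?S' J" by blast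
        obtain t where t: "sum t I = real_of_int (- 1)"
          "\<And>l. l \<in> I \<Longrightarrow> t l \<in> (if l \<in> J then {-1..} else {0..})"
          by (rule sliceE[OF z]) (rule that)
        have "sum t I \<ge> 0" by (rule sum_nonneg) (use t(2) True in auto)
        then show False using t(1) by simp
      qed
      then show ?thesis using True \<phi> by (simp add: lattice_valuation_def)
    next
      case False
      then have "card J > 0" using J I(1) finite_subset by (auto simp: card_gt_0_iff)
      then have "- 1 + int (card J) = int (card J - 1)" by simp
      from slice_shifted[OF I(1,2) J this, of v] False show ?thesis by (simp only:) simp
    qed
  qed
  also have "\<dots> = alternating_sum I (\<lambda>J. \<phi> (?S J))"
    by (rule slice_exchange[OF \<phi> I(1,3)])
  also have "\<dots> = alternating_sum I (\<lambda>J. of_bool (J \<noteq> {}) * \<phi> (uminus ` (convex hull (v ` J))))"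
  proof (rule alternating_sum_cong)
    fix J assume J: "J \<subseteq> I"
    then have finJ: "finite J" using I(1) finite_subset by blast
    have "?S J = uminus ` (convex hull (v ` J))"
      unfolding convex_hull_image_eq_slice[OF finJ]
    proof (intro subset_antisym subsetI)
      fix z assume z: "z \<in> ?S J"
      obtain t where t: "z = (\<Sum>l\<in>I. t l *\<^sub>R v l)" "sum t I = real_of_int (- 1)"
        "\<And>l. l \<in> I \<Longrightarrow> t l \<in> (if l \<in> J then {-1..0} else {0})"
        by (rule sliceE[OF z]) (rule that)
      have t0: "t l = 0" if "l \<in> I - J" for l using t(3)[of l] that by simp
      have "- z \<in> slice J v 1 (\<lambda>_. {0..})"
      proof (rule sliceI[where t = "\<lambda>l. - t l"])
        have "(\<Sum>l\<in>I. t l *\<^sub>R v l) = (\<Sum>l\<in>J. t l *\<^sub>R v l)"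
          using I(1) J t0 by (intro sum.mono_neutral_right) auto
        then show "- z = (\<Sum>l\<in>J. - t l *\<^sub>R v l)"
          unfolding t(1) by (simp add: sum_negf)
        have "sum t I = sum t J"
          using I(1) J t0 by (intro sum.mono_neutral_right) auto
        then show "(\<Sum>l\<in>J. - t l) = real_of_int 1" using t(2) by (simp add: sum_negf)
        show "- t l \<in> {0..}" if "l \<in> J" for l using t(3)[of l] that J by auto
      qed
      then show "z \<in> uminus ` slice J v 1 (\<lambda>_. {0..})" by force
    next
      fix z assume "z \<in> uminus ` slice J v 1 (\<lambda>_. {0..})"
      then have z: "- z \<in> slice J v 1 (\<lambda>_. {0..})" by auto
      obtain t where t: "- z = (\<Sum>l\<in>J. t l *\<^sub>R v l)" "sum t J = real_of_int 1"
        "\<And>l. l \<in> J \<Longrightarrow> t l \<in> {0..}"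
        by (rule sliceE[OF z]) (rule that)
      let ?t = "\<lambda>l. if l \<in> J then - t l else 0"
      show "z \<in> ?S J"
      proof (rule sliceI[where t = ?t])
        have "(\<Sum>l\<in>I. ?t l *\<^sub>R v l) = (\<Sum>l\<in>J. ?t l *\<^sub>R v l)"
          using I(1) J by (intro sum.mono_neutral_right) auto
        also have "\<dots> = - (\<Sum>l\<in>J. t l *\<^sub>R v l)" by (simp add: sum_negf)
        finally show "z = (\<Sum>l\<in>I. ?t l *\<^sub>R v l)" unfolding t(1)[symmetric] by simp
        have "sum ?t I = sum ?t J"
          using I(1) J by (intro sum.mono_neutral_right) auto
        then show "sum ?t I = real_of_int (- 1)" using t(2) by (simp add: sum_negf)
        fix l assume "l \<in> I"
        have "t l \<le> 1" if "l \<in> J"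
          using member_le_sum[of l J t] that finJ t by auto
        then show "?t l \<in> (if l \<in> J then {-1..0} else {0})" using t(3)[of l] by auto
      qed
    qed
    then show "\<phi> (?S J) = of_bool (J \<noteq> {}) * \<phi> (uminus ` (convex hull (v ` J)))"
      using \<phi> by (cases "J = {}") (auto simp: lattice_valuation_def)
  qed
  finally show ?thesis .
qed

section \<open>Homogeneous forms and iterated differences\<close>

text \<open>
  Homogeneous polynomial functions of a given degree, as sums of products of linear functionals.
\<close>

inductive form :: "nat \<Rightarrow> ('a::real_inner \<Rightarrow> real) \<Rightarrow> bool" where
  form_const: "form 0 (\<lambda>_. c)"
| form_mult: "form j f \<Longrightarrow> form (Suc j) (\<lambda>x. (x \<bullet> w) * f x)"
| form_add: "form j f \<Longrightarrow> form j g \<Longrightarrow> form j (\<lambda>x. f x + g x)"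

lemma form_cmult: "form j f \<Longrightarrow> form j (\<lambda>x. c * f x)"
proof (induction rule: form.induct)
  case (form_mult j f w)
  then show ?case using form.form_mult[of j "\<lambda>x. c * f x" w] by (simp add: mult.left_commute)
qed (auto simp: distrib_left intro: form.intros)

lemma form_zero: "form j (\<lambda>_. 0)"
proof (induction j)
  case (Suc j)
  show ?case using form_mult[OF Suc, of 0] by simp
qed (rule form_const)

lemma form_sum: "(\<And>s. s \<in> S \<Longrightarrow> form j (f s)) \<Longrightarrow> form j (\<lambda>x. \<Sum>s\<in>S. f s x)"
  by (induction S rule: infinite_finite_induct) (auto intro: form_zero form_add)

lemma form_scaleR: "form j f \<Longrightarrow> f (t *\<^sub>R x) = t ^ j * f x"
  by (induction rule: form.induct) (auto simp: algebra_simps)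

lemma form_continuous: "form j f \<Longrightarrow> continuous_on UNIV f"
  by (induction rule: form.induct) (auto intro!: continuous_intros)

lemma form_snd:
  "form j f \<Longrightarrow> form j (\<lambda>p :: 'b::real_inner \<times> 'a::real_inner. f (snd p))"
proof (induction rule: form.induct)
  case (form_mult j f w)
  then show ?case
    using form.form_mult[of j "\<lambda>p :: 'b \<times> 'a. f (snd p)" "(0, w)"] by (simp add: inner_prod_def)
qed (auto intro: form.intros)

lemma form_fst_power:
  fixes f :: "real \<times> 'a::real_inner \<Rightarrow> real"
  assumes "form j f"
  shows "form (m + j) (\<lambda>p. fst p ^ m * f p)"
proof (induction m)
  case (Suc m)
  show ?case using form_mult[OF Suc, of "(1, 0)"] by (simp add: inner_prod_def mult.assoc)
qed (use assms in simp)

text \<open>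
  All \<open>d\<close>-fold differences of the function vanish; for continuous functions on
  \<open>\<real>^n\<close> these are the polynomials of degree less than \<open>d\<close>.
\<close>

primrec difference_order :: "nat \<Rightarrow> ('a::ab_group_add \<Rightarrow> real) \<Rightarrow> bool" where
  "difference_order 0 f \<longleftrightarrow> (\<forall>x. f x = 0)"
| "difference_order (Suc d) f \<longleftrightarrow> (\<forall>u. difference_order d (\<lambda>x. f (x + u) - f x))"

lemma difference_order_add:
  "difference_order d f \<Longrightarrow> difference_order d g \<Longrightarrow> difference_order d (\<lambda>x. f x + g x)"
proof (induction d arbitrary: f g)
  case (Suc d)
  have "difference_order d (\<lambda>x. (f (x + u) - f x) + (g (x + u) - g x))" for u
    using Suc by simp
  then show ?case by (simp add: algebra_simps)
qed simp

lemma difference_order_cmult: "difference_order d f \<Longrightarrow> difference_order d (\<lambda>x. c * f x)"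
proof (induction d arbitrary: f)
  case (Suc d)
  have "difference_order d (\<lambda>x. c * (f (x + u) - f x))" for u
    using Suc by simp
  then show ?case by (simp add: algebra_simps)
qed simp

lemma difference_order_translate: "difference_order d f \<Longrightarrow> difference_order d (\<lambda>x. f (x + y))"
proof (induction d arbitrary: f)
  case (Suc d)
  have "difference_order d (\<lambda>x. f (x + y + u) - f (x + y))" for u
    using Suc.IH[of "\<lambda>x. f (x + u) - f x"] Suc.prems by simp
  then show ?case by (simp add: add.commute add.left_commute)
qed simp

text \<open>
  Leibniz rule: the difference of \<open>(x \<bullet> w) * f x\<close> in direction \<open>u\<close> is
  \<open>(x \<bullet> w) * (f (x + u) - f x) + (u \<bullet> w) * f (x + u)\<close>.
\<close>

lemma difference_order_mult:
  fixes f :: "'a::real_inner \<Rightarrow> real"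
  shows "difference_order d f \<Longrightarrow> difference_order (Suc d) (\<lambda>x. (x \<bullet> w) * f x)"
proof (induction d arbitrary: f)
  case (Suc d)
  have "difference_order (Suc d) (\<lambda>x. (x \<bullet> w) * (f (x + u) - f x) + (u \<bullet> w) * f (x + u))" for u
    using Suc.IH[of "\<lambda>x. f (x + u) - f x"] Suc.prems
    by (intro difference_order_add difference_order_cmult difference_order_translate) auto
  moreover have "(\<lambda>x. (x \<bullet> w) * (f (x + u) - f x) + (u \<bullet> w) * f (x + u))
    = (\<lambda>x. ((x + u) \<bullet> w) * f (x + u) - (x \<bullet> w) * f x)" for u
    by (simp add: fun_eq_iff inner_add_left algebra_simps)
  ultimately show ?case by (simp only: difference_order.simps(2)[of "Suc d"]) simp
qed simp

lemma form_difference_order: "form j f \<Longrightarrow> difference_order (Suc j) f"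
proof (induction rule: form.induct)
  case (form_mult j f w)
  show ?case by (rule difference_order_mult[OF form_mult.IH])
next
  case (form_add j f g)
  show ?case by (rule difference_order_add[OF form_add.IH])
qed simp

lemma alternating_sum_difference_order:
  assumes "difference_order d f" "finite I" "d \<le> card I"
  shows "alternating_sum I (\<lambda>J. f (z + sum u J)) = 0"
  using assms
proof (induction d arbitrary: f I)
  case (Suc d)
  then obtain l I' where I: "I = insert l I'" "l \<notin> I'" "finite I'" "d \<le> card I'"
    by (metis Suc_le_D card_Suc_eq finite_insert Suc_le_mono)
  have "alternating_sum I (\<lambda>J. f (z + sum u J))
    = alternating_sum I' (\<lambda>J. f (z + sum u J)) - alternating_sum I' (\<lambda>J. f (z + sum u (insert l J)))"
    unfolding I(1) by (rule alternating_sum_insert[OF I(3,2)])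
  also have "\<dots> = alternating_sum I' (\<lambda>J. (- 1) * (f (z + sum u J + u l) - f (z + sum u J)))"
    unfolding alternating_sum_diff[symmetric]
  proof (rule alternating_sum_cong)
    fix J assume "J \<subseteq> I'"
    then have "finite J" "l \<notin> J" using I finite_subset by blast+
    then show "f (z + sum u J) - f (z + sum u (insert l J))
      = (- 1) * (f (z + sum u J + u l) - f (z + sum u J))"
      by (simp add: add.commute add.left_commute)
  qed
  also have "\<dots> = 0"
    unfolding alternating_sum_cmult
    using Suc.IH[of "\<lambda>x. f (x + u l) - f x" I'] Suc.prems(1) I(3,4) by simp
  finally show ?case .
qed simp

text \<open>
  The \<open>n\<close>-fold difference of \<open>x \<mapsto> 1 / x ^ s\<close> with step \<open>1\<close>, signed so that it is positive
  for \<open>s > 0\<close> and \<open>x > 0\<close>.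
\<close>

primrec inverse_power_difference :: "nat \<Rightarrow> nat \<Rightarrow> real \<Rightarrow> real" where
  "inverse_power_difference s 0 x = 1 / x ^ s"
| "inverse_power_difference s (Suc n) x
    = inverse_power_difference s n x - inverse_power_difference s n (x + 1)"

text \<open>
  Leibniz rule applied to \<open>1 / x ^ s = x * (1 / x ^ (s + 1))\<close>.
\<close>

lemma inverse_power_difference_rec:
  assumes "x > 0"
  shows "x * inverse_power_difference (Suc s) n x
    = inverse_power_difference s n x + real n * inverse_power_difference (Suc s) (n - 1) (x + 1)"
  using assms
proof (induction n arbitrary: x)
  case (Suc n)
  let ?a = inverse_power_difference
  have IH: "x * ?a (Suc s) n x = ?a s n x + real n * ?a (Suc s) (n - 1) (x + 1)"
    "(x + 1) * ?a (Suc s) n (x + 1) = ?a s n (x + 1) + real n * ?a (Suc s) (n - 1) (x + 1 + 1)"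
    using Suc by auto
  have n: "real n * ?a (Suc s) n (x + 1)
    = real n * ?a (Suc s) (n - 1) (x + 1) - real n * ?a (Suc s) (n - 1) (x + 1 + 1)"
    by (cases n) (simp_all add: algebra_simps)
  have "x * ?a (Suc s) (Suc n) x
    = x * ?a (Suc s) n x - (x + 1) * ?a (Suc s) n (x + 1) + ?a (Suc s) n (x + 1)"
    by (simp add: algebra_simps)
  then show ?case unfolding IH using n by (simp add: algebra_simps)
qed simp

lemma inverse_power_difference_0: "inverse_power_difference 0 n x = of_bool (n = 0)"
  by (induction n arbitrary: x) auto

lemma inverse_power_difference_pos:
  assumes "x > 0"
  shows "inverse_power_difference (Suc s) n x > 0"
  using assms
proof (induction s arbitrary: n x)
  case 0
  then show ?case
  proof (induction n arbitrary: x)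
    case (Suc n)
    have "x * inverse_power_difference (Suc 0) (Suc n) x > 0"
      using inverse_power_difference_rec[OF Suc.prems, of 0 "Suc n"] Suc.IH[of "x + 1"] Suc.prems
      by (simp only: inverse_power_difference_0) simp
    then show ?case using Suc.prems by (simp only: zero_less_mult_pos)
  qed simp
next
  case (Suc s)
  note outer = Suc.IH
  show ?case
    using Suc.prems
  proof (induction n arbitrary: x)
    case (Suc n)
    have "inverse_power_difference (Suc s) (Suc n) x > 0" by (rule outer) fact
    moreover have "inverse_power_difference (Suc (Suc s)) n (x + 1) > 0" using Suc by simp
    ultimately have "x * inverse_power_difference (Suc (Suc s)) (Suc n) x > 0"
      unfolding inverse_power_difference_rec[OF Suc.prems] by (simp add: add_pos_pos del: inverse_power_difference.simps)
    then show ?case using Suc.prems by (simp only: zero_less_mult_pos)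
  qed simp
qed

lemma alternating_sum_inverse_power:
  assumes "finite I"
  shows "alternating_sum I (\<lambda>J. 1 / (x + real (card J)) ^ s) = inverse_power_difference s (card I) x"
  using assms
proof (induction I arbitrary: x rule: finite_induct)
  case (insert l I)
  have "alternating_sum I (\<lambda>J. 1 / (x + real (card (insert l J))) ^ s)
    = alternating_sum I (\<lambda>J. 1 / ((x + 1) + real (card J)) ^ s)"
  proof (rule alternating_sum_cong)
    fix J assume "J \<subseteq> I"
    then have "finite J" "l \<notin> J" using insert finite_subset by blast+
    then show "1 / (x + real (card (insert l J))) ^ s = 1 / ((x + 1) + real (card J)) ^ s"
      by (simp add: add.assoc)
  qed
  then show ?case
    using insert by (simp add: alternating_sum_insert)
qed simp

section \<open>Homogeneous covariant valuations\<close>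

lemma lattice_polytope_translate:
  assumes "P \<in> lattice_polytopes" "y \<in> int_lattice"
  shows "(\<lambda>x. x + y) ` P \<in> lattice_polytopes"
proof -
  obtain V where V: "finite V" "V \<subseteq> int_lattice" "P = convex hull V"
    using lattice_polytope_generators[OF assms(1)] .
  have "(\<lambda>x. x + y) ` P = convex hull ((\<lambda>x. x + y) ` V)"
    unfolding V(3) using convex_hull_translation[of y V] by (simp add: add.commute image_image)
  then show ?thesis
    using V assms(2) by (auto intro!: convex_hull_in_lattice_polytopes int_lattice_add)
qed

lemma lattice_polytope_scaleR:
  assumes "P \<in> lattice_polytopes"
  shows "(\<lambda>x. real k *\<^sub>R x) ` P \<in> lattice_polytopes"
proof -
  obtain V where V: "finite V" "V \<subseteq> int_lattice" "P = convex hull V"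
    using lattice_polytope_generators[OF assms] .
  have "(\<lambda>x. real k *\<^sub>R x) ` P = convex hull ((\<lambda>x. real k *\<^sub>R x) ` V)"
    unfolding V(3) by (rule convex_hull_scaling[symmetric])
  then show ?thesis
    using V by (auto intro!: convex_hull_in_lattice_polytopes int_lattice_scaleR)
qed

lemma lattice_valuation_translate:
  fixes \<phi> :: "(real ^ 'n) set \<Rightarrow> real"
  assumes \<phi>: "lattice_valuation \<phi>" and y: "y \<in> int_lattice"
  shows "lattice_valuation (\<lambda>P. \<phi> ((\<lambda>x. x + y) ` P))"
  unfolding lattice_valuation_def
proof (intro conjI allI impI)
  show "\<phi> ((\<lambda>x. x + y) ` {}) = 0" using \<phi> by (simp add: lattice_valuation_def)
  fix P Q :: "(real ^ 'n) set"
  assume PQ: "P \<in> lattice_polytopes \<and> Q \<in> lattice_polytopes \<and> P \<union> Q \<in> lattice_polytopes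
    \<and> P \<inter> Q \<in> lattice_polytopes"
  have eq: "(\<lambda>x. x + y) ` (P \<union> Q) = (\<lambda>x. x + y) ` P \<union> (\<lambda>x. x + y) ` Q"
    "(\<lambda>x. x + y) ` (P \<inter> Q) = (\<lambda>x. x + y) ` P \<inter> (\<lambda>x. x + y) ` Q"
    by (simp add: image_Un) (rule image_Int, simp)
  have "(\<lambda>x. x + y) ` P \<union> (\<lambda>x. x + y) ` Q \<in> lattice_polytopes"
    "(\<lambda>x. x + y) ` P \<inter> (\<lambda>x. x + y) ` Q \<in> lattice_polytopes"
    using PQ lattice_polytope_translate[OF _ y] unfolding eq[symmetric] by blast+
  then show "\<phi> ((\<lambda>x. x + y) ` P) + \<phi> ((\<lambda>x. x + y) ` Q)
    = \<phi> ((\<lambda>x. x + y) ` (P \<union> Q)) + \<phi> ((\<lambda>x. x + y) ` (P \<inter> Q))"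
    unfolding eq using \<phi> PQ lattice_polytope_translate[OF _ y] unfolding lattice_valuation_def by blast
qed

lemma alternating_sum_empty_only:
  fixes I :: "'b set"
  assumes "finite I"
  shows "alternating_sum I (\<lambda>J. of_bool (J = {}) * c) = c"
proof -
  have "alternating_sum I (\<lambda>J. of_bool (J = {}) * c)
    = (\<Sum>J\<in>{{} :: 'b set}. (- 1) ^ card J * (of_bool (J = {}) * c))"
    unfolding alternating_sum_def
  proof (rule sum.mono_neutral_right)
    show "\<forall>J\<in>Pow I - {{}}. (- 1) ^ card J * (of_bool (J = {}) * c) = 0" by simp
  qed (use assms in auto)
  then show ?thesis by simp
qed

lemma polynomial_zero_on_nat:
  fixes c :: "nat \<Rightarrow> real"
  assumes "\<And>t::nat. (\<Sum>j\<le>r. c j * real t ^ j) = 0" "j \<le> r"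
  shows "c j = 0"
proof (rule ccontr)
  assume "c j \<noteq> 0"
  then have "finite {x. (\<Sum>i\<le>r. c i * x ^ i) = 0}"
    using assms(2) polyfun_finite_roots[of c r] by blast
  moreover have "range real \<subseteq> {x. (\<Sum>i\<le>r. c i * x ^ i) = 0}" using assms(1) by auto
  ultimately have "finite (range real)" using finite_subset by blast
  then show False using finite_imageD[of real UNIV] by (simp add: inj_on_def)
qed

lemma uminus_image_convex_hull:
  "uminus ` (convex hull U) = convex hull (uminus ` U)"
  by (rule convex_hull_linear_image) (rule linear_uminus)

text \<open>
  For fixed arguments of the tensors, translation covariance makes the value at \<open>P + y\<close> a polynomial in \<open>y\<close>
  of degree at most \<open>r\<close>, for each polytope \<open>P\<close> separately.
\<close>

locale homogeneous_covariant_valuation =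
  fixes \<phi> :: "(real ^ 'n) set \<Rightarrow> real" and i r :: nat
  assumes valuation: "lattice_valuation \<phi>"
    and homogeneous: "P \<in> lattice_polytopes \<Longrightarrow> \<phi> ((\<lambda>x. real k *\<^sub>R x) ` P) = real k ^ i * \<phi> P"
    and covariant: "P \<in> lattice_polytopes \<Longrightarrow>
      \<exists>A. (\<forall>j\<le>r. form j (A j)) \<and> (\<forall>y\<in>int_lattice. \<phi> ((\<lambda>x. x + y) ` P) = (\<Sum>j\<le>r. A j y))"
begin

text \<open>
  Since \<open>k P + k t y = k (P + t y)\<close>, homogeneity relates the polynomials of \<open>k P\<close> and of \<open>P\<close> at
  all natural numbers \<open>t\<close>; compare coefficients.
\<close>

lemma dilate_translate:
  assumes P: "P \<in> lattice_polytopes"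
    and A: "\<And>j. j \<le> r \<Longrightarrow> form j (A j)"
      "\<And>y. y \<in> int_lattice \<Longrightarrow> \<phi> ((\<lambda>x. x + y) ` P) = (\<Sum>j\<le>r. A j y)"
    and k: "k > 0" and y: "y \<in> int_lattice"
  shows "\<phi> ((\<lambda>x. x + y) ` ((\<lambda>x. real k *\<^sub>R x) ` P)) = (\<Sum>j\<le>r. real k ^ i / real k ^ j * A j y)"
proof -
  obtain B where B: "\<And>j. j \<le> r \<Longrightarrow> form j (B j)"
    "\<And>y. y \<in> int_lattice \<Longrightarrow> \<phi> ((\<lambda>x. x + y) ` ((\<lambda>x. real k *\<^sub>R x) ` P)) = (\<Sum>j\<le>r. B j y)"
    using covariant[OF lattice_polytope_scaleR[OF P]] by blast
  have "B j y * real k ^ j - real k ^ i * A j y = 0" if "j \<le> r" for j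
  proof (rule polynomial_zero_on_nat[where r = r, OF _ that])
    fix t :: nat
    have mem: "real t *\<^sub>R y \<in> int_lattice" "real (k * t) *\<^sub>R y \<in> int_lattice"
      using y by (auto intro: int_lattice_scaleR)
    have "(\<lambda>x. x + real (k * t) *\<^sub>R y) ` ((\<lambda>x. real k *\<^sub>R x) ` P)
      = (\<lambda>x. real k *\<^sub>R x) ` ((\<lambda>x. x + real t *\<^sub>R y) ` P)"
      by (simp add: image_image scaleR_add_right)
    then have "(\<Sum>j\<le>r. B j (real (k * t) *\<^sub>R y)) = real k ^ i * (\<Sum>j\<le>r. A j (real t *\<^sub>R y))"
      using B(2)[OF mem(2)] A(2)[OF mem(1)] homogeneous[OF lattice_polytope_translate[OF P mem(1)]] by simp
    moreover have "(\<Sum>j\<le>r. B j (real (k * t) *\<^sub>R y)) = (\<Sum>j\<le>r. B j y * real k ^ j * real t ^ j)"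
      by (rule sum.cong) (simp_all add: form_scaleR[OF B(1)] power_mult_distrib mult_ac)
    moreover have "real k ^ i * (\<Sum>j\<le>r. A j (real t *\<^sub>R y)) = (\<Sum>j\<le>r. real k ^ i * A j y * real t ^ j)"
      unfolding sum_distrib_left by (rule sum.cong) (simp_all add: form_scaleR[OF A(1)] mult_ac)
    ultimately show "(\<Sum>j\<le>r. (B j y * real k ^ j - real k ^ i * A j y) * real t ^ j) = 0"
      by (simp add: left_diff_distrib sum_subtractf)
  qed
  then have "B j y = real k ^ i / real k ^ j * A j y" if "j \<le> r" for j
    using k that by (simp add: field_simps)
  then show ?thesis using B(2)[OF y] by simp
qed

lemma alternating_sum_translates:
  fixes v :: "'b \<Rightarrow> real ^ 'n"
  assumes I: "finite I" "I \<noteq> {}" "v ` I \<subseteq> int_lattice" and y: "y \<in> int_lattice"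
  shows "alternating_sum I (\<lambda>J. \<phi> ((\<lambda>x. x + (y - sum v J)) `
    ((\<lambda>x. real (k + card J) *\<^sub>R x) ` (convex hull (v ` I))))) = 0"
  using alternating_sum_Minkowski[OF lattice_valuation_translate[OF valuation y] I, of k]
  by (simp add: image_image algebra_simps)

text \<open>
  Otherwise \<open>\<phi> (k P + y)\<close> would contain a term with a negative power of \<open>k\<close>. Let \<open>m\<close> be the largest
  degree of a form that does not vanish. The growth of order \<open>t ^ m\<close> in the vanishing sum
  for the translates by \<open>t y0\<close> of the dilates by \<open>1 + |J|\<close> is \<open>A m y0\<close> times an iterated
  difference of \<open>x \<mapsto> 1 / x ^ (m - i)\<close> at \<open>1\<close>, which is positive.
\<close>

lemma form_vanishes:
  assumes P: "P \<in> lattice_polytopes" "P \<noteq> {}"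
    and A: "\<And>j. j \<le> r \<Longrightarrow> form j (A j)"
      "\<And>y. y \<in> int_lattice \<Longrightarrow> \<phi> ((\<lambda>x. x + y) ` P) = (\<Sum>j\<le>r. A j y)"
    and j: "i < j" "j \<le> r" and y: "y \<in> int_lattice"
  shows "A j y = 0"
proof (rule ccontr)
  assume "A j y \<noteq> 0"
  let ?Q = "\<lambda>m. m \<le> r \<and> (\<exists>y\<in>int_lattice. A m y \<noteq> 0)"
  have "?Q j" using j y \<open>A j y \<noteq> 0\<close> by blast
  then obtain m where m: "?Q m" and max: "\<And>m'. ?Q m' \<Longrightarrow> m' \<le> m"
    using GreatestI_nat[of ?Q j r] Greatest_le_nat[of ?Q _ r] by blast
  have im: "i < m" using max[OF \<open>?Q j\<close>] j by simp
  obtain y0 where y0: "y0 \<in> int_lattice" "A m y0 \<noteq> 0" using m by blast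
  obtain V where V: "finite V" "V \<subseteq> int_lattice" "P = convex hull V"
    using lattice_polytope_generators[OF P(1)] .
  have V': "V \<noteq> {}" "id ` V \<subseteq> int_lattice" using V P(2) by auto
  let ?w = "\<lambda>J j. real (1 + card J) ^ i / real (1 + card J) ^ j"
  \<comment> \<open>The sum of the values at \<open>(1 + |J|) P + t y0 - (\<Sum>J)\<close>, divided by \<open>t ^ m\<close>.\<close>
  let ?h = "\<lambda>t. alternating_sum V (\<lambda>J. \<Sum>j\<le>m. ?w J j * ((real t ^ j / real t ^ m) * A j (y0 - (1 / real t) *\<^sub>R sum id J)))"
  have h0: "?h t = 0" if t: "t > 0" for t
  proof -
    have ty: "real t *\<^sub>R y0 \<in> int_lattice" using y0 by (auto intro: int_lattice_scaleR)
    have "real t ^ m * ?h t = alternating_sum V (\<lambda>J. real t ^ m * (\<Sum>j\<le>m. ?w J j *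
        ((real t ^ j / real t ^ m) * A j (y0 - (1 / real t) *\<^sub>R sum id J))))"
      by (simp only: alternating_sum_cmult)
    also have "\<dots> = alternating_sum V (\<lambda>J. \<phi> ((\<lambda>x. x + (real t *\<^sub>R y0 - sum id J)) `
        ((\<lambda>x. real (1 + card J) *\<^sub>R x) ` (convex hull (id ` V)))))"
    proof (rule alternating_sum_cong)
      fix J assume J: "J \<subseteq> V"
      let ?z = "real t *\<^sub>R y0 - sum id J"
      have "sum id J \<in> int_lattice" using J V by (intro int_lattice_sum) auto
      then have z: "?z \<in> int_lattice"
        using int_lattice_add[OF ty int_lattice_minus] by simp
      have "real t ^ m * (\<Sum>j\<le>m. ?w J j * ((real t ^ j / real t ^ m) * A j (y0 - (1 / real t) *\<^sub>R sum id J)))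
        = (\<Sum>j\<le>m. ?w J j * A j ?z)"
        unfolding sum_distrib_left
      proof (rule sum.cong[OF refl])
        fix j assume "j \<in> {..m}"
        then have "form j (A j)" using A(1) m by simp
        moreover have "?z = real t *\<^sub>R (y0 - (1 / real t) *\<^sub>R sum id J)"
          using t by (simp add: scaleR_diff_right)
        ultimately have "A j ?z = real t ^ j * A j (y0 - (1 / real t) *\<^sub>R sum id J)"
          using form_scaleR by metis
        then show "real t ^ m * (?w J j * ((real t ^ j / real t ^ m) * A j (y0 - (1 / real t) *\<^sub>R sum id J)))
          = ?w J j * A j ?z"
          using t by simp
      qed
      also have "\<dots> = (\<Sum>j\<le>r. ?w J j * A j ?z)"
      proof (rule sum.mono_neutral_left)
        have "A j ?z = 0" if "j \<le> r" "\<not> j \<le> m" for j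
          using max[of j] z that by blast
        then show "\<forall>j\<in>{..r} - {..m}. ?w J j * A j ?z = 0" by simp
      qed (use m in auto)
      also have "\<dots> = \<phi> ((\<lambda>x. x + ?z) ` ((\<lambda>x. real (1 + card J) *\<^sub>R x) ` P))"
        using dilate_translate[OF P(1) A, of "1 + card J" ?z] z by simp
      finally show "real t ^ m * (\<Sum>j\<le>m. ?w J j * ((real t ^ j / real t ^ m) * A j (y0 - (1 / real t) *\<^sub>R sum id J)))
        = \<phi> ((\<lambda>x. x + ?z) ` ((\<lambda>x. real (1 + card J) *\<^sub>R x) ` (convex hull (id ` V))))"
        using V(3) by simp
    qed
    also have "\<dots> = 0" by (rule alternating_sum_translates[OF V(1) V' ty])
    finally show ?thesis using t by simp
  qed
  have "?h \<longlonglongrightarrow> alternating_sum V (\<lambda>J. \<Sum>j\<le>m. ?w J j * (of_bool (j = m) * A j y0))"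
    unfolding alternating_sum_def
  proof (intro tendsto_sum tendsto_mult tendsto_const)
    fix J j assume "j \<in> {..m}"
    then have jm: "j \<le> m" by simp
    have "(\<lambda>t. real t ^ j / real t ^ m) \<longlonglongrightarrow> of_bool (j = m)"
    proof (cases "j = m")
      case True
      have "eventually (\<lambda>t. real t ^ j / real t ^ m = 1) sequentially"
        using eventually_gt_at_top[of 0] by eventually_elim (simp add: True)
      then show ?thesis using True by (simp add: tendsto_eventually)
    next
      case False
      have "eventually (\<lambda>t. (1 / real t) ^ (m - j) = real t ^ j / real t ^ m) sequentially"
        using eventually_gt_at_top[of 0]
        by eventually_elim (use jm in \<open>simp add: power_one_over power_diff divide_simps\<close>)
      moreover have "(\<lambda>t. (1 / real t) ^ (m - j)) \<longlonglongrightarrow> 0 ^ (m - j)"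
        by (intro tendsto_power lim_1_over_n)
      ultimately have "(\<lambda>t. real t ^ j / real t ^ m) \<longlonglongrightarrow> 0 ^ (m - j)"
        by (rule Lim_transform_eventually[rotated])
      moreover have "m - j > 0" using False jm by simp
      ultimately show ?thesis using False by (simp add: power_0_left)
    qed
    then show "(\<lambda>t. real t ^ j / real t ^ m) \<longlonglongrightarrow> of_bool (j = m)" .
    have "(\<lambda>t. y0 - (1 / real t) *\<^sub>R sum id J) \<longlonglongrightarrow> y0 - 0 *\<^sub>R sum id J"
      by (intro tendsto_intros lim_1_over_n)
    moreover have "isCont (A j) y0"
      using form_continuous[OF A(1)] jm m continuous_on_eq_continuous_at[of UNIV "A j"] by simp
    ultimately show "(\<lambda>t. A j (y0 - (1 / real t) *\<^sub>R sum id J)) \<longlonglongrightarrow> A j y0"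
      using isCont_tendsto_compose[of y0 "A j"] by simp
  qed
  moreover have "?h \<longlonglongrightarrow> 0"
    by (rule tendsto_eventually, rule eventually_mono[OF eventually_gt_at_top[of 0]], rule h0)
  ultimately have lim_0: "alternating_sum V (\<lambda>J. \<Sum>j\<le>m. ?w J j * (of_bool (j = m) * A j y0)) = 0"
    using LIMSEQ_unique by blast
  have lim_J: "(\<Sum>j\<le>m. ?w J j * (of_bool (j = m) * A j y0)) = A m y0 * (1 / (1 + real (card J)) ^ Suc (m - i - 1))" for J
  proof -
    have "(\<Sum>j\<le>m. ?w J j * (of_bool (j = m) * A j y0)) = (\<Sum>j\<le>m. if j = m then ?w J j * A j y0 else 0)"
      by (rule sum.cong) auto
    also have "\<dots> = ?w J m * A m y0" by simp
    also have "?w J m = 1 / (1 + real (card J)) ^ (m - i)"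
    proof -
      have "real (1 + card J) ^ m = real (1 + card J) ^ i * real (1 + card J) ^ (m - i)"
        using im by (simp flip: power_add)
      then show ?thesis by simp
    qed
    finally show ?thesis using im by (simp add: Suc_diff_Suc)
  qed
  have "A m y0 * inverse_power_difference (Suc (m - i - 1)) (card V) 1 = 0"
    using lim_0 unfolding lim_J alternating_sum_cmult alternating_sum_inverse_power[OF V(1)] .
  then show False using y0 inverse_power_difference_pos[of 1 "m - i - 1" "card V"] by simp
qed

text \<open>
  \<open>H\<close> is the form of degree \<open>i\<close> that agrees with \<open>(k, y) \<mapsto> \<phi> (k P + y)\<close> for natural
  numbers \<open>k\<close> and lattice points \<open>y\<close>. Its differences in the
  directions \<open>(1, - v l)\<close> vanish everywhere, since there are more than \<open>i\<close> of them. Starting at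
  \<open>k = 0\<close> this determines the value of \<open>\<phi>\<close> at single points, and starting at \<open>k = -1\<close> it
  expresses \<open>H (-1, 0)\<close> by values of \<open>\<phi>\<close> at the polytopes \<open>(|J| - 1) P - (\<Sum>l\<in>J. v l)\<close>.
\<close>

theorem reflection:
  fixes v :: "'b \<Rightarrow> real ^ 'n"
  assumes I: "finite I" "v ` I \<subseteq> int_lattice" and card: "i < card I"
  shows "(- 1) ^ i * \<phi> (convex hull (v ` I))
    = - alternating_sum I (\<lambda>J. of_bool (J \<noteq> {}) * \<phi> (uminus ` (convex hull (v ` J))))"
proof -
  define P where "P = convex hull (v ` I)"
  have I0: "I \<noteq> {}" using card by auto
  have P: "P \<in> lattice_polytopes" "P \<noteq> {}"
    using I I0 by (auto simp: P_def intro: convex_hull_in_lattice_polytopes)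
  obtain A where A: "\<And>j. j \<le> r \<Longrightarrow> form j (A j)"
    "\<And>y. y \<in> int_lattice \<Longrightarrow> \<phi> ((\<lambda>x. x + y) ` P) = (\<Sum>j\<le>r. A j y)"
    using covariant[OF P(1)] by blast
  \<comment> \<open>At \<open>fst p = 0\<close> only the form of degree \<open>i\<close> survives, because \<open>0 ^ 0 = 1\<close>.\<close>
  define H where "H p = (\<Sum>j\<in>{..min i r}. fst p ^ (i - j) * A j (snd p))" for p :: "real \<times> (real ^ 'n)"
  have form_H: "form i H"
  proof -
    have "form i (\<lambda>p :: real \<times> (real ^ 'n). fst p ^ (i - j) * A j (snd p))" if "j \<le> min i r" for j
      using form_fst_power[OF form_snd[OF A(1)], of j "i - j"] that by simp
    then show ?thesis unfolding H_def by (intro form_sum) auto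
  qed
  let ?g = "\<lambda>k y. \<phi> ((\<lambda>x. x + y) ` ((\<lambda>x. real k *\<^sub>R x) ` P))"
  have sum_mem: "sum v J \<in> int_lattice" if "J \<subseteq> I" for J
    using that I by (intro int_lattice_sum) auto
  have H_differences: "alternating_sum I (\<lambda>J. H (a + real (card J), y - sum v J)) = 0" for a y
  proof -
    have "alternating_sum I (\<lambda>J. H ((a, y) + (\<Sum>l\<in>J. (1, - v l)))) = 0"
      by (rule alternating_sum_difference_order[OF form_difference_order[OF form_H] I(1)]) (use card in simp)
    moreover have "(\<Sum>l\<in>J. (1 :: real, - v l)) = (real (card J), - sum v J)" for J
      by (induction J rule: infinite_finite_induct) (auto simp: zero_prod_def)
    ultimately show ?thesis by simp
  qed
  have g_pos: "?g k y = H (real k, y)" if k: "k > 0" and y: "y \<in> int_lattice" for k y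
  proof -
    have "?g k y = (\<Sum>j\<le>r. real k ^ i / real k ^ j * A j y)"
      by (rule dilate_translate[OF P(1) A k y])
    also have "\<dots> = (\<Sum>j\<le>min i r. real k ^ i / real k ^ j * A j y)"
      using form_vanishes[OF P A _ _ y] by (intro sum.mono_neutral_right) auto
    also have "\<dots> = H (real k, y)"
      unfolding H_def by (rule sum.cong) (use k in \<open>simp_all add: power_diff\<close>)
    finally show ?thesis .
  qed
  have g_0: "?g 0 y = H (0, y)" if y: "y \<in> int_lattice" for y
  proof -
    let ?D = "\<lambda>J. ?g (card J) (y - sum v J) - H (real (card J), y - sum v J)"
    have "alternating_sum I ?D = 0"
      using alternating_sum_translates[OF I(1) I0 I(2) y, of 0] H_differences[of 0 y]
      by (simp add: alternating_sum_diff P_def)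
    moreover have "alternating_sum I ?D = alternating_sum I (\<lambda>J. of_bool (J = {}) * ?D {})"
    proof (rule alternating_sum_cong)
      fix J assume J: "J \<subseteq> I"
      have "?D J = 0" if "J \<noteq> {}"
      proof -
        have "card J > 0" using J I(1) that finite_subset by (auto simp: card_gt_0_iff)
        moreover have "y - sum v J \<in> int_lattice"
          using int_lattice_add[OF y int_lattice_minus[OF sum_mem[OF J]]] by simp
        ultimately show ?thesis using g_pos by simp
      qed
      then show "?D J = of_bool (J = {}) * ?D {}" by (cases "J = {}") auto
    qed
    moreover have "alternating_sum I (\<lambda>J. of_bool (J = {}) * ?D {}) = ?D {}"
      by (rule alternating_sum_empty_only[OF I(1)])
    ultimately show ?thesis by simp
  qed
  have g: "?g k y = H (real k, y)" if "y \<in> int_lattice" for k y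
    using g_pos[of k y] g_0[of y] that by (cases "k = 0") auto
  have "alternating_sum I (\<lambda>J. of_bool (J \<noteq> {}) * \<phi> (uminus ` (convex hull (v ` J))))
    = alternating_sum I (\<lambda>J. of_bool (J \<noteq> {}) * \<phi> ((\<lambda>x. x - sum v J) `
      ((\<lambda>x. real (card J - 1) *\<^sub>R x) ` P)))"
    unfolding P_def by (rule alternating_sum_Minkowski_inverse[OF valuation I(1) I0 I(2), symmetric])
  also have "\<dots> = alternating_sum I (\<lambda>J. H (- 1 + real (card J), 0 - sum v J) - of_bool (J = {}) * H (- 1, 0))"
  proof (rule alternating_sum_cong)
    fix J assume J: "J \<subseteq> I"
    show "of_bool (J \<noteq> {}) * \<phi> ((\<lambda>x. x - sum v J) ` ((\<lambda>x. real (card J - 1) *\<^sub>R x) ` P))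
      = H (- 1 + real (card J), 0 - sum v J) - of_bool (J = {}) * H (- 1, 0)"
    proof (cases "J = {}")
      case False
      then have "card J > 0" using J I(1) finite_subset by (auto simp: card_gt_0_iff)
      then have "real (card J - 1) = - 1 + real (card J)" by simp
      then show ?thesis
        using False g[OF int_lattice_minus[OF sum_mem[OF J]], of "card J - 1"] by simp
    qed simp
  qed
  also have "\<dots> = - alternating_sum I (\<lambda>J. of_bool (J = {}) * H (- 1, 0))"
    unfolding alternating_sum_diff H_differences by simp
  also have "alternating_sum I (\<lambda>J. of_bool (J = {}) * H (- 1, 0)) = H (- 1, 0)"
    by (rule alternating_sum_empty_only[OF I(1)])
  also have "H (- 1, 0) = (- 1) ^ i * H (1, 0)"
    using form_scaleR[OF form_H, of "- 1" "(1, 0)"] by simp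
  also have "H (1, 0) = \<phi> P" using g[of 0 1] by simp
  finally show ?thesis unfolding P_def by simp
qed

text \<open>
  Each generator is repeated \<open>i + 1\<close> times to have more than \<open>i\<close> of them; repetitions do not change the
  alternating sum.
\<close>

corollary reflection_set:
  assumes V: "finite V" "V \<noteq> {}" "V \<subseteq> int_lattice"
  shows "(- 1) ^ i * \<phi> (convex hull V)
    = - alternating_sum V (\<lambda>U. of_bool (U \<noteq> {}) * \<phi> (uminus ` (convex hull U)))"
proof -
  let ?I = "V \<times> {..i}"
  let ?f = "\<lambda>U. of_bool (U \<noteq> {}) * \<phi> (uminus ` (convex hull U))"
  have fst_I: "fst ` ?I = V" by force
  have "card V \<ge> 1" using V by (simp add: Suc_le_eq card_gt_0_iff)
  then have "1 * Suc i \<le> card V * Suc i" by (rule mult_le_mono1)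
  then have card_I: "i < card ?I" by (simp add: card_cartesian_product)
  have fin_I: "finite ?I" using V by simp
  have "(- 1) ^ i * \<phi> (convex hull V)
    = - alternating_sum ?I (\<lambda>J. of_bool (J \<noteq> {}) * \<phi> (uminus ` (convex hull (fst ` J))))"
    using reflection[OF fin_I _ card_I, of fst] V(3) unfolding fst_I by blast
  also have "alternating_sum ?I (\<lambda>J. of_bool (J \<noteq> {}) * \<phi> (uminus ` (convex hull (fst ` J))))
    = alternating_sum ?I (\<lambda>J. ?f (fst ` J))"
    by (rule alternating_sum_cong) simp
  also have "\<dots> = alternating_sum ((\<lambda>x. (x, 0 :: nat)) ` V) (\<lambda>J. ?f (fst ` J))"
    by (rule alternating_sum_image_duplicates[where v = fst and f = ?f]) (use V in \<open>auto simp: image_image\<close>)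
  also have "\<dots> = alternating_sum V ?f"
    by (subst alternating_sum_reindex) (auto simp: image_image inj_on_def)
  finally show ?thesis .
qed

sublocale reciprocal_pair \<phi> "\<lambda>P. (- 1) ^ i * \<phi> (uminus ` P)" i
proof
  fix V :: "(real ^ 'n) set" assume V: "finite V" "V \<noteq> {}" "V \<subseteq> int_lattice"
  have sq: "(- 1) ^ i * ((- 1) ^ i * z) = (z :: real)" for z
    by (simp flip: mult.assoc power_add)
  show "\<phi> (convex hull V) = - alternating_sum V (\<lambda>U. of_bool (U \<noteq> {}) * ((- 1) ^ i * \<phi> (uminus ` (convex hull U))))"
  proof -
    have "\<phi> (convex hull V) = (- 1) ^ i * ((- 1) ^ i * \<phi> (convex hull V))" by (simp add: sq)
    also have "\<dots> = - ((- 1) ^ i * alternating_sum V (\<lambda>U. of_bool (U \<noteq> {}) * \<phi> (uminus ` (convex hull U))))"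
      unfolding reflection_set[OF V] by simp
    finally show ?thesis by (simp add: mult.left_commute flip: alternating_sum_cmult)
  qed
  have V': "finite (uminus ` V)" "uminus ` V \<noteq> {}" "uminus ` V \<subseteq> int_lattice"
    using V by (auto intro: int_lattice_minus)
  show "(- 1) ^ i * \<phi> (uminus ` (convex hull V)) = - alternating_sum V (\<lambda>U. of_bool (U \<noteq> {}) * \<phi> (convex hull U))"
    unfolding uminus_image_convex_hull reflection_set[OF V']
    by (subst alternating_sum_reindex) (auto simp: image_image inj_on_def)
next
  fix V :: "(real ^ 'n) set" and k assume V: "finite V" "V \<subseteq> int_lattice"
  have P: "convex hull V \<in> lattice_polytopes" using V by (rule convex_hull_in_lattice_polytopes)
  show "\<phi> (convex hull ((*\<^sub>R) (real k) ` V)) = real k ^ i * \<phi> (convex hull V)"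
    using homogeneous[OF P, of k] by (simp add: convex_hull_scaling)
  have "convex hull (uminus ` V) \<in> lattice_polytopes"
    using V by (intro convex_hull_in_lattice_polytopes) (auto intro: int_lattice_minus)
  from homogeneous[OF this, of k]
  show "(- 1) ^ i * \<phi> (uminus ` (convex hull ((*\<^sub>R) (real k) ` V)))
    = real k ^ i * ((- 1) ^ i * \<phi> (uminus ` (convex hull V)))"
    by (simp add: uminus_image_convex_hull convex_hull_scaling[symmetric] image_image)
qed

corollary reciprocity:
  assumes "P \<in> lattice_polytopes"
  shows "face_sum \<phi> P = (- 1) ^ i * \<phi> (uminus ` P)"
proof -
  obtain V where V: "finite V" "V \<subseteq> int_lattice" "P = convex hull V"
    using lattice_polytope_generators[OF assms] .
  show ?thesis
  proof (cases "V = {}")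
    case True
    then show ?thesis using V valuation by (simp add: lattice_valuation_def)
  qed (use face_sum_eq V in blast)
qed

end

section \<open>Tensor valuations\<close>

lemma form_tensor_power: "form j (\<lambda>y. tensor_power y j w)"
proof (induction j)
  case 0
  show ?case using form_const[of 1] by (simp add: tensor_power_def)
next
  case (Suc j)
  show ?case using form_mult[OF Suc, of "w j"] by (simp add: tensor_power_def mult.commute)
qed

lemma form_sym_prod: "form j (\<lambda>y. sym_prod p j B (tensor_power y j) v)"
proof -
  have "form j (\<lambda>y. (1 / fact (p + j)) * (\<Sum>\<sigma> | \<sigma> permutes {..<p + j}.
      B (\<lambda>k. v (\<sigma> k)) * tensor_power y j (\<lambda>k. v (\<sigma> (p + k)))))"
    by (intro form_cmult form_sum form_tensor_power)
  then show ?thesis by (simp add: sym_prod_def)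
qed

theorem theorem17:
  fixes Z :: "(real ^ 'n::finite) set \<Rightarrow> 'n tensor" and r i :: nat and P :: "(real ^ 'n) set"
  assumes "CARD('n) \<ge> 2" and "r \<ge> 1"
    and "tensor_valuation r Z"
    and "homogeneous i Z"
    and "translation_covariant r Z"
    and "P \<in> lattice_polytopes"
  shows "face_alternating_sum Z P = (\<lambda>v. (- 1) ^ i * Z (uminus ` P) v)"
proof
  fix v
  interpret homogeneous_covariant_valuation "\<lambda>Q. Z Q v" i r
  proof
    show "lattice_valuation (\<lambda>Q. Z Q v)"
      using assms(3) unfolding tensor_valuation_def lattice_valuation_def by blast
    show "Z ((\<lambda>x. real k *\<^sub>R x) ` Q) v = real k ^ i * Z Q v" if "Q \<in> lattice_polytopes" for Q k
      using assms(4) that unfolding homogeneous_def by blast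
    fix Q :: "(real ^ 'n) set" assume Q: "Q \<in> lattice_polytopes"
    obtain Zs :: "nat \<Rightarrow> (real ^ 'n) set \<Rightarrow> 'n tensor" where
      Zs: "\<And>y. y \<in> int_lattice \<Longrightarrow> Z ((\<lambda>x. x + y) ` Q) v =
        (\<Sum>j\<le>r. sym_prod (r - j) j (Zs (r - j) Q) (tensor_power y j) v / fact j)"
      using assms(5) Q unfolding translation_covariant_def by blast
    \<comment> \<open>Every summand of the covariance formula is a form in \<open>y\<close> of the degree of its tensor power.\<close>
    let ?A = "\<lambda>j y. (1 / fact j) * sym_prod (r - j) j (Zs (r - j) Q) (tensor_power y j) v"
    have "\<forall>j\<le>r. form j (?A j)" by (intro allI impI form_cmult form_sym_prod)
    moreover have "\<forall>y\<in>int_lattice. Z ((\<lambda>x. x + y) ` Q) v = (\<Sum>j\<le>r. ?A j y)"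
      using Zs by simp
    ultimately show "\<exists>A. (\<forall>j\<le>r. form j (A j)) \<and>
        (\<forall>y\<in>int_lattice. Z ((\<lambda>x. x + y) ` Q) v = (\<Sum>j\<le>r. A j y))"
      by (intro exI[of _ ?A]) blast
  qed
  show "face_alternating_sum Z P v = (- 1) ^ i * Z (uminus ` P) v"
    using reciprocity[OF assms(6)] unfolding face_sum_def face_alternating_sum_def .
qed

end
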